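(* For each positive integer $N$ let $C_N$ be the optimal (smallest) constant such that $$\prod_{i=1}^N\|z-z_i\|\leqslant C_N\left\|\prod_{i=1}^N(z-z_i)\right\|\quad\text{for all } z_1,\ldots,z_N\in\mathbb{C},$$ where the norms are Bombieri-Weyl norms of polynomials in $z$, and define $K_N$ by $C_N=K_N\sqrt{\frac{e^N}{N+1}}$. Then $$\limsup_{N\to\infty}K_N\geqslant\frac{e^{C_{\log}}}{\sqrt{3}\,e^{15/8}}\geqslant 0.08.$$
   Context: The Bombieri-Weyl norm of a degree $d$ polynomial $f(z)=\sum_{i=0}^d a_iz^i$ is $\|f\|=\left(\sum_{i=0}^d\binom{d}{i}^{-1}|a_i|^2\right)^{1/2}$; in particular the linear factor $z-z_i$ has norm $\|z-z_i\|=\sqrt{1+|z_i|^2}$, and $\prod_{i=1}^N(z-z_i)$ is regarded as a polynomial of degree $N$. The constant $C_{\log}$ is defined as follows. Let $\mathbb{S}\subset\mathbb{R}^3$ be the unit sphere and $m_N=\min_{p_1,\ldots,p_N\in\mathbb{S}}\sum_{i\neq j}\log\frac{1}{|p_i-p_j|}$ (sum over ordered pairs $i\neq j$). It is known that $m_N=\kappa N^2-\frac12 N\log N+C_{\log}N+o(N)$ as $N\to\infty$, where $\kappa=\frac12-\log2$; that is, $C_{\log}=\lim_{N\to\infty}\frac1N\left(m_N-\kappa N^2+\frac12N\log N\right)$. It is known that $-0.0954\ldots\leqslant C_{\log}\leqslant -0.0556\ldots$. *)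

theory Defs
  imports "HOL-Analysis.Analysis" "HOL-Computational_Algebra.Polynomial"
begin

definition bw_norm :: "complex poly \<Rightarrow> real" where
  "bw_norm f = sqrt (\<Sum>i\<le>degree f. (cmod (coeff f i))\<^sup>2 / real (degree f choose i))"

text \<open>Since \<open>\<Prod>i=1..N. [:- z i, 1:]\<close> is monic, its degree is exactly \<open>N\<close>, so
  \<open>bw_norm\<close> weighs its coefficients by \<open>N choose i\<close>.  The set of admissible constants is
  closed and bounded below, so its infimum is its smallest element.\<close>

definition bombieri_const :: "nat \<Rightarrow> real" where
  "bombieri_const N = Inf {C. \<forall>z :: nat \<Rightarrow> complex.
     (\<Prod>i=1..N. bw_norm [:- z i, 1:]) \<le> C * bw_norm (\<Prod>i=1..N. [:- z i, 1:])}"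

definition bombieri_K :: "nat \<Rightarrow> real" where
  "bombieri_K N = bombieri_const N / sqrt (exp (real N) / (real N + 1))"

definition log_energy :: "nat \<Rightarrow> (nat \<Rightarrow> real ^ 3) \<Rightarrow> real" where
  "log_energy N p = (\<Sum>i\<in>{1..N}. \<Sum>j\<in>{1..N} - {i}. ln (1 / norm (p i - p j)))"

text \<open>Configurations with coinciding points have energy \<open>+\<infinity>\<close> and never attain the minimum.
  They have to be excluded explicitly, because \<open>ln (1 / 0) = 0\<close> here.\<close>

definition min_log_energy :: "nat \<Rightarrow> real" where
  "min_log_energy N =
     Inf {log_energy N p | p. p ` {1..N} \<subseteq> sphere 0 1 \<and> inj_on p {1..N}}"

end

theory Submission
  imports Defs "HOL-Probability.Probability" "HOL-Combinatorics.Permutations"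
    "HOL-Computational_Algebra.Fundamental_Theorem_Algebra"
begin

text \<open>
  Both inequalities follow from three estimates that involve neither explicit configurations
  nor the exact value of \<open>C_log\<close>.

  The normalised Bombieri constant satisfies \<open>bombieri_K N \<ge> exp (- 2 / sqrt pi)\<close>, about \<open>0.32\<close>, for
  every \<open>N\<close> (\<open>bombieri_K_ge\<close>).  For a polynomial \<open>P\<close> of degree \<open>N\<close> let \<open>F\<close> be the function
  \<open>(cmod (poly P w))\<^sup>2 / (1 + (cmod w)\<^sup>2) ^ N\<close> on the sphere.  The mean of \<open>ln F\<close> over the sphere is, by Jensen's formula applied to each
  root, the logarithm of the squared leading coefficient times the product of the squared norms of the linear factors,
  minus \<open>N\<close>.  So it suffices to find a \<open>P\<close> for which \<open>ln F\<close> is not too negative on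
  average while \<open>bw_norm P\<close> is not too large.  A Gaussian random polynomial has this property in
  the mean, since at each point its normalised value is Gaussian and has a bounded logarithm in expectation.  In order to
  avoid singular integrals, the mean over the sphere is replaced by one over a fine finite grid, for which the
  needed half of Jensen's formula is an inequality between products (\<open>prod_nodes_le\<close>).

  The constant \<open>C_log\<close> is at least \<open>ln 2 - 1 / 2 - euler_mascheroni / 2\<close>.  In terms of spinors, the interaction of
  two points is a power series with nonnegative coefficients in the squared inner product, each of whose terms is bounded
  by Welch's inequality (\<open>welch_bound\<close>, \<open>log_energy_ge\<close>).  This already gives the bound by \<open>0.08\<close>.

  The constant \<open>C_log\<close> is at most \<open>ln 2 + 1 / 4 + ln (10 / 9)\<close>, because the largest Vandermonde determinant is at least the
  quadratic mean of all of them, and this mean can be computed by orthogonality (\<open>exists_large_det\<close>, \<open>exists_low_energy\<close>).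
  With this bound \<open>exp C_log / (sqrt 3 * exp (15 / 8))\<close> is smaller than \<open>exp (- 2 / sqrt pi)\<close>, so the
  first estimate implies the claim on the limes superior.
\<close>

section \<open>Points of the sphere as unit spinors\<close>

text \<open>
  The Hopf map: a unit vector \<open>(x, y)\<close> of \<open>\<complex>\<^sup>2\<close> represents a point of the sphere, and \<open>y / x\<close> is its
  stereographic coordinate.  Working with spinors keeps the point at infinity on the same footing
  as the others, and makes the distance of two points a \<open>2 \<times> 2\<close> determinant.
\<close>

definition sphere_pt :: "complex \<Rightarrow> complex \<Rightarrow> real ^ 3" where
  "sphere_pt x y = vector [2 * Re (cnj x * y), 2 * Im (cnj x * y), (cmod x)\<^sup>2 - (cmod y)\<^sup>2]"

text \<open>
  The two complementary quantities attached to a pair of spinors: the determinant is half the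
  distance of the points, and the inner product is therefore large when the points are close.
\<close>

lemma spinor_pythagoras:
  "(cmod (cnj x * x' + cnj y * y'))\<^sup>2 + (cmod (x * y' - y * x'))\<^sup>2
     = ((cmod x)\<^sup>2 + (cmod y)\<^sup>2) * ((cmod x')\<^sup>2 + (cmod y')\<^sup>2)"
  unfolding cmod_power2 by (simp add: power2_eq_square algebra_simps)

lemma norm_vec3_squared: "(norm (v :: real ^ 3))\<^sup>2 = (v $ 1)\<^sup>2 + (v $ 2)\<^sup>2 + (v $ 3)\<^sup>2"
  unfolding power2_norm_eq_inner by (simp add: inner_vec_def sum_3 power2_eq_square)

lemma norm_sphere_pt_squared:
  "(norm (sphere_pt x y))\<^sup>2 = ((cmod x)\<^sup>2 + (cmod y)\<^sup>2)\<^sup>2"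
  unfolding norm_vec3_squared sphere_pt_def
  unfolding cmod_power2 vector_3 by (simp add: power2_eq_square algebra_simps)

lemma dist_sphere_pt:
  assumes "(cmod x)\<^sup>2 + (cmod y)\<^sup>2 = 1" "(cmod x')\<^sup>2 + (cmod y')\<^sup>2 = 1"
  shows "norm (sphere_pt x y - sphere_pt x' y') = 2 * cmod (x * y' - y * x')"
proof -
  have inner: "sphere_pt x y \<bullet> sphere_pt x' y'
      = ((cmod x)\<^sup>2 + (cmod y)\<^sup>2) * ((cmod x')\<^sup>2 + (cmod y')\<^sup>2) - 2 * (cmod (x * y' - y * x'))\<^sup>2"
    unfolding cmod_power2 sphere_pt_def inner_vec_def sum_3 vector_3
    by (simp add: power2_eq_square algebra_simps)
  have "(norm (sphere_pt x y - sphere_pt x' y'))\<^sup>2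
      = (norm (sphere_pt x y))\<^sup>2 + (norm (sphere_pt x' y'))\<^sup>2 - 2 * (sphere_pt x y \<bullet> sphere_pt x' y')"
    by (simp add: power2_norm_eq_inner algebra_simps inner_commute)
  also have "\<dots> = (2 * cmod (x * y' - y * x'))\<^sup>2"
    unfolding inner norm_sphere_pt_squared using assms by (simp add: power_mult_distrib)
  finally show ?thesis by (rule power2_eq_imp_eq) auto
qed

lemma sphere_pt_surj:
  assumes "norm (p :: real ^ 3) = 1"
  obtains x y where "(cmod x)\<^sup>2 + (cmod y)\<^sup>2 = 1" "sphere_pt x y = p"
proof -
  have unit: "(p $ 1)\<^sup>2 + (p $ 2)\<^sup>2 + (p $ 3)\<^sup>2 = 1"
    using assms norm_vec3_squared[of p] by simp
  show thesis
  proof (cases "p $ 3 = -1")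
    case True
    then have "p $ 1 = 0" "p $ 2 = 0" using unit
      by (smt (verit) power2_minus one_power2 zero_le_power2 zero_eq_power2)+
    then have "sphere_pt 0 1 = p"
      using True by (simp add: sphere_pt_def vec_eq_iff forall_3)
    then show thesis using that[of 0 1] by simp
  next
    case False
    have "(p $ 3)\<^sup>2 \<le> 1" using unit by (smt (verit) zero_le_power2)
    then have "\<bar>p $ 3\<bar> \<le> 1" by (simp add: abs_square_le_1)
    with False have pos: "1 + p $ 3 > 0" by linarith
    define a where "a = sqrt ((1 + p $ 3) / 2)"
    have a: "a > 0" "a\<^sup>2 = (1 + p $ 3) / 2" using pos by (auto simp: a_def)
    define y where "y = Complex (p $ 1 / (2 * a)) (p $ 2 / (2 * a))"
    have ymod: "(cmod y)\<^sup>2 = (1 - p $ 3) / 2"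
    proof -
      have "(cmod y)\<^sup>2 = ((p $ 1)\<^sup>2 + (p $ 2)\<^sup>2) / (4 * a\<^sup>2)"
        by (simp add: y_def cmod_power2 power_divide power_mult_distrib add_divide_distrib)
      also have "(p $ 1)\<^sup>2 + (p $ 2)\<^sup>2 = (1 - p $ 3) * (1 + p $ 3)"
        using unit by (simp add: power2_eq_square algebra_simps)
      also have "4 * a\<^sup>2 = 2 * (1 + p $ 3)" by (simp add: a(2))
      finally have "(cmod y)\<^sup>2 = (1 - p $ 3) * (1 + p $ 3) / (2 * (1 + p $ 3))" .
      also have "\<dots> = (1 - p $ 3) / 2" using pos by (intro divide_eq_eq[THEN iffD2]) (auto simp: field_simps)
      finally show ?thesis .
    qed
    have xmod: "(cmod (complex_of_real a))\<^sup>2 = (1 + p $ 3) / 2"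
      using a by simp
    have "sphere_pt (of_real a) y = p"
      unfolding sphere_pt_def vec_eq_iff forall_3 xmod ymod
      using a(1) by (simp add: y_def field_simps)
    moreover have "(cmod (complex_of_real a))\<^sup>2 + (cmod y)\<^sup>2 = 1"
      unfolding xmod ymod by (simp add: field_simps)
    ultimately show thesis using that by blast
  qed
qed

section \<open>A lower bound for the energy\<close>

text \<open>
  Welch's inequality.  The \<open>k\<close>-th powers of the spinors are unit vectors in the symmetric power of
  \<open>\<complex>\<^sup>2\<close>, which has dimension \<open>k + 1\<close>.  The left-hand side is the squared Hilbert-Schmidt norm of
  their frame operator \<open>T\<close>, a matrix of size \<open>k + 1\<close> with trace \<open>card I\<close>, and the
  Cauchy-Schwarz inequality on the diagonal bounds it from below.
\<close>

lemma welch_bound: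
  fixes x y :: "'i \<Rightarrow> complex"
  assumes "finite I" and unit: "\<And>i. i \<in> I \<Longrightarrow> (cmod (x i))\<^sup>2 + (cmod (y i))\<^sup>2 = 1"
  shows "(\<Sum>i\<in>I. \<Sum>j\<in>I. (cmod (cnj (x i) * x j + cnj (y i) * y j)) ^ (2 * k))
           \<ge> (real (card I))\<^sup>2 / (real k + 1)"
proof -
  define w where "w i l = sqrt (real (k choose l)) *\<^sub>R (x i ^ l * y i ^ (k - l))" for i l
  have gram: "(\<Sum>l\<le>k. cnj (w i l) * w j l) = (cnj (x i) * x j + cnj (y i) * y j) ^ k" for i j
  proof -
    have "cnj (w i l) * w j l
        = of_nat (k choose l) * (cnj (x i) * x j) ^ l * (cnj (y i) * y j) ^ (k - l)" for l
    proof -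
      have "cnj (w i l) * w j l = of_real (sqrt (real (k choose l)) * sqrt (real (k choose l)))
          * (cnj (x i) * x j) ^ l * (cnj (y i) * y j) ^ (k - l)"
        unfolding w_def scaleR_conv_of_real of_real_mult
        by (simp add: power_mult_distrib mult_ac)
      then show ?thesis by simp
    qed
    then show ?thesis by (simp add: binomial_ring)
  qed
  have sq: "of_real ((cmod z)\<^sup>2) = z * cnj z" for z by (rule complex_norm_square)
  have norm_w: "(\<Sum>l\<le>k. (cmod (w i l))\<^sup>2) = 1" if "i \<in> I" for i
  proof -
    have "complex_of_real (\<Sum>l\<le>k. (cmod (w i l))\<^sup>2) = (\<Sum>l\<le>k. cnj (w i l) * w i l)"
      by (simp only: of_real_sum sq mult.commute)
    also have "\<dots> = (of_real ((cmod (x i))\<^sup>2 + (cmod (y i))\<^sup>2)) ^ k"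
      unfolding gram of_real_add sq by (simp add: mult.commute)
    also have "\<dots> = 1" using unit[OF that] by simp
    finally show ?thesis using of_real_eq_1_iff by blast
  qed
  define T where "T l m = (\<Sum>i\<in>I. w i l * cnj (w i m))" for l m
  have "complex_of_real (\<Sum>i\<in>I. \<Sum>j\<in>I. (cmod (cnj (x i) * x j + cnj (y i) * y j)) ^ (2 * k))
      = (\<Sum>i\<in>I. \<Sum>j\<in>I. (\<Sum>l\<le>k. cnj (w i l) * w j l) * cnj (\<Sum>m\<le>k. cnj (w i m) * w j m))"
    unfolding gram of_real_sum
    by (intro sum.cong refl) (simp only: sq[symmetric] norm_power power_mult[symmetric] mult.commute)
  also have "\<dots> = (\<Sum>i\<in>I. \<Sum>j\<in>I. \<Sum>l\<le>k. \<Sum>m\<le>k. cnj (w i l) * w j l * (w i m * cnj (w j m)))"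
    by (simp add: sum_product)
  also have "\<dots> = (\<Sum>i\<in>I. \<Sum>l\<le>k. \<Sum>j\<in>I. \<Sum>m\<le>k. cnj (w i l) * w j l * (w i m * cnj (w j m)))"
    by (intro sum.cong refl, rule sum.swap)
  also have "\<dots> = (\<Sum>l\<le>k. \<Sum>i\<in>I. \<Sum>j\<in>I. \<Sum>m\<le>k. cnj (w i l) * w j l * (w i m * cnj (w j m)))"
    by (rule sum.swap)
  also have "\<dots> = (\<Sum>l\<le>k. \<Sum>i\<in>I. \<Sum>m\<le>k. \<Sum>j\<in>I. cnj (w i l) * w j l * (w i m * cnj (w j m)))"
    by (intro sum.cong refl, rule sum.swap)
  also have "\<dots> = (\<Sum>l\<le>k. \<Sum>m\<le>k. \<Sum>i\<in>I. \<Sum>j\<in>I. cnj (w i l) * w j l * (w i m * cnj (w j m)))"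
    by (intro sum.cong refl, rule sum.swap)
  also have "\<dots> = (\<Sum>l\<le>k. \<Sum>m\<le>k. cnj (T l m) * T l m)"
    unfolding T_def cnj_sum sum_product by (intro sum.cong refl) (simp add: mult_ac)
  also have "\<dots> = complex_of_real (\<Sum>l\<le>k. \<Sum>m\<le>k. (cmod (T l m))\<^sup>2)"
    by (simp only: of_real_sum sq mult.commute)
  finally have eq: "(\<Sum>i\<in>I. \<Sum>j\<in>I. (cmod (cnj (x i) * x j + cnj (y i) * y j)) ^ (2 * k))
      = (\<Sum>l\<le>k. \<Sum>m\<le>k. (cmod (T l m))\<^sup>2)"
    using of_real_eq_iff by blast
  have diag: "cmod (T l l) = (\<Sum>i\<in>I. (cmod (w i l))\<^sup>2)" for l
  proof -
    have "T l l = of_real (\<Sum>i\<in>I. (cmod (w i l))\<^sup>2)" unfolding T_def of_real_sum sq ..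
    then show ?thesis by (simp only: norm_of_real) (simp add: sum_nonneg)
  qed
  have "(\<Sum>l\<le>k. cmod (T l l)) = (\<Sum>i\<in>I. \<Sum>l\<le>k. (cmod (w i l))\<^sup>2)"
    unfolding diag by (rule sum.swap)
  also have "\<dots> = real (card I)" by (simp add: norm_w)
  finally have trace: "(\<Sum>l\<le>k. cmod (T l l)) = real (card I)" .
  have "(real (card I))\<^sup>2 \<le> (\<Sum>l\<le>k. (cmod (T l l))\<^sup>2) * (\<Sum>l\<le>k. 1\<^sup>2)"
    using Cauchy_Schwarz_ineq_sum[of "\<lambda>l. cmod (T l l)" "\<lambda>l. 1" "{..k}"] by (simp add: trace)
  then have "(real (card I))\<^sup>2 / (real k + 1) \<le> (\<Sum>l\<le>k. (cmod (T l l))\<^sup>2)"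
    by (simp add: field_simps)
  also have "\<dots> \<le> (\<Sum>l\<le>k. \<Sum>m\<le>k. (cmod (T l m))\<^sup>2)"
    by (intro sum_mono member_le_sum) auto
  finally show ?thesis unfolding eq .
qed

lemma ln_one_minus_le_truncated:
  fixes c :: real assumes "0 \<le> c" "c < 1"
  shows "(\<Sum>k=1..n. c ^ k / real k) \<le> - ln (1 - c)"
proof -
  define f where "f t = - ln (1 - t) - (\<Sum>k=1..n. t ^ k / real k)" for t :: real
  have "f 0 \<le> f c"
  proof (rule DERIV_nonneg_imp_nondecreasing[OF assms(1)])
    fix t assume t: "0 \<le> t" "t \<le> c"
    with assms have t1: "t < 1" by linarith
    have "(f has_real_derivative (1 / (1 - t) - (\<Sum>k=1..n. t ^ (k - 1)))) (at t)"
      unfolding f_def using t1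
      by (auto intro!: derivative_eq_intros sum.cong simp: divide_simps)
    moreover have "(\<Sum>k=1..n. t ^ (k - 1)) = (1 - t ^ n) / (1 - t)"
    proof -
      have "(\<Sum>k=1..n. t ^ (k - 1)) = (\<Sum>k<n. t ^ k)"
        by (rule sum.reindex_bij_witness[of _ Suc "\<lambda>k. k - 1"]) auto
      then show ?thesis using t1 sum_gp_strict[of t n] by simp
    qed
    moreover have "1 / (1 - t) - (1 - t ^ n) / (1 - t) \<ge> 0"
      using t t1 by (simp add: divide_simps)
    ultimately show "\<exists>y. (f has_real_derivative y) (at t) \<and> 0 \<le> y" by auto
  qed
  moreover have "f 0 = 0" by (auto simp: f_def intro!: sum.neutral)
  ultimately show ?thesis by (simp add: f_def)
qed

text \<open>
  With \<open>c\<close> the squared modulus of the inner product of two spinors, the interaction is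
  \<open>- ln 2 - ln (1 - c) / 2 = - ln 2 + (\<Sum>k. c ^ k / k) / 2\<close>.  Every power \<open>c ^ k\<close> satisfies Welch's inequality,
  so the series may be truncated; stopping at \<open>k = N - 1\<close> balances what the tail would contribute
  against the diagonal terms \<open>i = j\<close>, which have to be subtracted.
\<close>

theorem log_energy_ge:
  assumes "N \<ge> 1" and sph: "p ` {1..N} \<subseteq> sphere 0 1" and inj: "inj_on p {1..N}"
  shows "log_energy N p \<ge> - real N * (real N - 1) * ln 2
           + (real N * (real N - 1) - real N * harm (N - 1)) / 2"
proof -
  have "\<forall>i\<in>{1..N}. \<exists>v. (cmod (fst v))\<^sup>2 + (cmod (snd v))\<^sup>2 = 1 \<and> sphere_pt (fst v) (snd v) = p i"
  proof
    fix i assume "i \<in> {1..N}"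
    with sph have "p i \<in> sphere 0 1" by blast
    then have "norm (p i) = 1" by simp
    then show "\<exists>v. (cmod (fst v))\<^sup>2 + (cmod (snd v))\<^sup>2 = 1 \<and> sphere_pt (fst v) (snd v) = p i"
      by (metis sphere_pt_surj fst_conv snd_conv)
  qed
  then obtain v where v: "\<forall>i\<in>{1..N}. (cmod (fst (v i)))\<^sup>2 + (cmod (snd (v i)))\<^sup>2 = 1
      \<and> sphere_pt (fst (v i)) (snd (v i)) = p i" by metis
  define x y where "x i = fst (v i)" and "y i = snd (v i)" for i
  have unit: "(cmod (x i))\<^sup>2 + (cmod (y i))\<^sup>2 = 1" and pt: "sphere_pt (x i) (y i) = p i"
    if "i \<in> {1..N}" for i using v that by (auto simp: x_def y_def)
  define c where "c i j = (cmod (cnj (x i) * x j + cnj (y i) * y j))\<^sup>2" for i j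
  have pair: "- ln 2 + (\<Sum>k=1..N-1. c i j ^ k / real k) / 2 \<le> ln (1 / norm (p i - p j))"
    if i: "i \<in> {1..N}" and j: "j \<in> {1..N} - {i}" for i j
  proof -
    define d where "d = cmod (x i * y j - y i * x j)"
    have nd: "norm (p i - p j) = 2 * d"
      using dist_sphere_pt[of "x i" "y i" "x j" "y j"] unit[of i] unit[of j] pt[of i] pt[of j] i j
      by (simp add: d_def)
    have "p i \<noteq> p j" using i j inj by (auto dest: inj_onD)
    then have d: "d > 0" using nd by (smt (verit) zero_less_norm_iff right_minus_eq)
    have cd: "c i j = 1 - d\<^sup>2"
      using spinor_pythagoras[of "x i" "x j" "y i" "y j"] unit[of i] unit[of j] i j
      by (simp add: c_def d_def)
    have "(\<Sum>k=1..N-1. c i j ^ k / real k) \<le> - ln (1 - c i j)"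
      by (rule ln_one_minus_le_truncated) (use cd d zero_le_power2[of "cmod (cnj (x i) * x j + cnj (y i) * y j)"] in
              \<open>simp_all add: c_def\<close>)
    also have "\<dots> = - 2 * ln d" using d by (simp add: cd ln_realpow)
    finally show ?thesis using d by (simp add: nd ln_div ln_mult)
  qed
  have sum_k: "(\<Sum>i\<in>{1..N}. \<Sum>j\<in>{1..N} - {i}. c i j ^ k) \<ge> (real N)\<^sup>2 / (real k + 1) - real N" for k
  proof -
    have "(\<Sum>j\<in>{1..N} - {i}. c i j ^ k) = (\<Sum>j\<in>{1..N}. c i j ^ k) - 1" if "i \<in> {1..N}" for i
    proof -
      have "c i i = 1"
      proof -
        have "cnj (x i) * x i + cnj (y i) * y i = of_real ((cmod (x i))\<^sup>2 + (cmod (y i))\<^sup>2)"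
          by (simp only: of_real_add complex_norm_square mult.commute)
        then show ?thesis using unit[OF that] by (simp add: c_def)
      qed
      then show ?thesis using that by (simp add: sum_diff1)
    qed
    then have "(\<Sum>i\<in>{1..N}. \<Sum>j\<in>{1..N} - {i}. c i j ^ k)
        = (\<Sum>i\<in>{1..N}. \<Sum>j\<in>{1..N}. c i j ^ k) - real N"
      by (simp add: sum_subtractf)
    moreover have "(\<Sum>i\<in>{1..N}. \<Sum>j\<in>{1..N}. c i j ^ k) \<ge> (real N)\<^sup>2 / (real k + 1)"
      using welch_bound[of "{1..N}" x y k] unit by (simp add: c_def power_mult)
    ultimately show ?thesis by simp
  qed
  have cards: "(\<Sum>i\<in>{1..N}. \<Sum>j\<in>{1..N} - {i}. (a::real)) = real N * (real N - 1) * a" for a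
    using assms(1) by (simp add: of_nat_diff)
  have telescope: "(\<Sum>k=1..N-1. 1 / (real k * (real k + 1))) = 1 - 1 / real N"
    using assms(1)
  proof (induction N rule: dec_induct)
    case (step n)
    then have "(\<Sum>k=1..Suc n - 1. 1 / (real k * (real k + 1)))
        = (\<Sum>k=1..n-1. 1 / (real k * (real k + 1))) + 1 / (real n * (real n + 1))"
      by (cases n) auto
    also have "\<dots> = 1 - 1 / real n + 1 / (real n * (real n + 1))" using step by simp
    also have "\<dots> = 1 - 1 / real (Suc n)"
    proof -
      have "real n * real n + real n \<noteq> 0" using step.hyps
        by (metis add_nonneg_eq_0_iff mult_eq_0_iff not_one_le_zero of_nat_0_eq_iff of_nat_0_le_iff zero_le_mult_iff)
      then show ?thesis using step.hyps by (simp add: field_simps)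
    qed
    finally show ?case .
  qed simp
  have "- real N * (real N - 1) * ln 2 + (real N * (real N - 1) - real N * harm (N - 1)) / 2
      = - real N * (real N - 1) * ln 2 + (\<Sum>k=1..N-1. ((real N)\<^sup>2 / (real k + 1) - real N) / real k) / 2"
  proof -
    have "(\<Sum>k=1..N-1. ((real N)\<^sup>2 / (real k + 1) - real N) / real k)
        = (\<Sum>k=1..N-1. (real N)\<^sup>2 * (1 / (real k * (real k + 1))) - real N * inverse (real k))"
      by (intro sum.cong refl) (simp add: right_diff_distrib divide_inverse mult_ac)
    also have "\<dots> = (real N)\<^sup>2 * (1 - 1 / real N) - real N * harm (N - 1)"
      unfolding sum_subtractf sum_distrib_left[symmetric] telescope by (simp add: harm_def)
    also have "(real N)\<^sup>2 * (1 - 1 / real N) = real N * (real N - 1)"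
      using assms(1) by (simp add: field_simps power2_eq_square)
    finally show ?thesis by simp
  qed
  also have "\<dots> \<le> - real N * (real N - 1) * ln 2
      + (\<Sum>k=1..N-1. (\<Sum>i\<in>{1..N}. \<Sum>j\<in>{1..N} - {i}. c i j ^ k) / real k) / 2"
    using sum_k by (intro add_left_mono divide_right_mono sum_mono) auto
  also have "(\<Sum>k=1..N-1. (\<Sum>i\<in>{1..N}. \<Sum>j\<in>{1..N} - {i}. c i j ^ k) / real k)
      = (\<Sum>i\<in>{1..N}. \<Sum>j\<in>{1..N} - {i}. \<Sum>k=1..N-1. c i j ^ k / real k)"
  proof -
    have "(\<Sum>k=1..N-1. (\<Sum>i\<in>{1..N}. \<Sum>j\<in>{1..N} - {i}. c i j ^ k) / real k)
        = (\<Sum>i\<in>{1..N}. \<Sum>k=1..N-1. \<Sum>j\<in>{1..N} - {i}. c i j ^ k / real k)"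
      unfolding sum_divide_distrib by (rule sum.swap)
    also have "\<dots> = (\<Sum>i\<in>{1..N}. \<Sum>j\<in>{1..N} - {i}. \<Sum>k=1..N-1. c i j ^ k / real k)"
      by (intro sum.cong refl sum.swap)
    finally show ?thesis .
  qed
  also have "- real N * (real N - 1) * ln 2 + \<dots> / 2
      = (\<Sum>i\<in>{1..N}. \<Sum>j\<in>{1..N} - {i}. - ln 2 + (\<Sum>k=1..N-1. c i j ^ k / real k) / 2)"
    unfolding sum.distrib cards sum_divide_distrib[symmetric] by simp
  also have "\<dots> \<le> log_energy N p"
    unfolding log_energy_def by (intro sum_mono pair)
  finally show ?thesis .
qed

section \<open>Vandermonde determinants\<close>

definition vandermonde_det :: "nat \<Rightarrow> (nat \<Rightarrow> complex) \<Rightarrow> complex" where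
  "vandermonde_det n z = (\<Sum>\<sigma> | \<sigma> permutes {..<n}. of_int (sign \<sigma>) * (\<Prod>i<n. z i ^ \<sigma> i))"

lemma vandermonde_det_eq_0:
  assumes ij: "i < n" "j < n" "i \<noteq> j" and eq: "z i = z j"
  shows "vandermonde_det n z = 0"
proof -
  define \<tau> where "\<tau> = Transposition.transpose i j"
  have \<tau>: "\<tau> permutes {..<n}" unfolding \<tau>_def by (rule permutes_swap_id) (use ij in auto)
  have z\<tau>: "z (\<tau> k) = z k" for k using eq by (simp add: \<tau>_def Transposition.transpose_def)
  have "vandermonde_det n z
      = (\<Sum>\<sigma> | \<sigma> permutes {..<n}. of_int (sign (\<sigma> \<circ> \<tau>)) * (\<Prod>k<n. z k ^ (\<sigma> \<circ> \<tau>) k))"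
    unfolding vandermonde_det_def by (rule sum_permutations_compose_right[OF \<tau>])
  also have "\<dots> = (\<Sum>\<sigma> | \<sigma> permutes {..<n}. - (of_int (sign \<sigma>) * (\<Prod>k<n. z k ^ \<sigma> k)))"
  proof (intro sum.cong refl)
    fix \<sigma> assume "\<sigma> \<in> {\<sigma>. \<sigma> permutes {..<n}}"
    then have \<sigma>: "\<sigma> permutes {..<n}" by simp
    have "sign (\<sigma> \<circ> \<tau>) = - sign \<sigma>"
      using \<sigma> \<tau> ij by (subst sign_compose) (auto simp: \<tau>_def sign_swap_id intro: permutation_permutes[THEN iffD2])
    moreover have "(\<Prod>k<n. z k ^ (\<sigma> \<circ> \<tau>) k) = (\<Prod>k<n. z k ^ \<sigma> k)"
      using prod.permute[OF \<tau>, of "\<lambda>k. z k ^ \<sigma> k"] by (simp add: o_def z\<tau>)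
    ultimately show "of_int (sign (\<sigma> \<circ> \<tau>)) * (\<Prod>k<n. z k ^ (\<sigma> \<circ> \<tau>) k)
        = - (of_int (sign \<sigma>) * (\<Prod>k<n. z k ^ \<sigma> k))" by simp
  qed
  also have "\<dots> = - vandermonde_det n z" by (simp add: sum_negf vandermonde_det_def)
  finally show ?thesis by simp
qed

text \<open>
  As a polynomial in its last variable, the determinant has degree at most \<open>n\<close>, vanishes at the other
  variables, and has the smaller determinant as its coefficient of degree \<open>n\<close>.
\<close>

lemma vandermonde_det_Suc:
  "vandermonde_det (Suc n) z = vandermonde_det n z * (\<Prod>i<n. z n - z i)"
proof (cases "inj_on z {..<n}")
  case False
  then obtain i j where ij: "i < n" "j < n" "i \<noteq> j" "z i = z j" by (auto simp: inj_on_def)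
  then show ?thesis
    using vandermonde_det_eq_0[of i n j z] vandermonde_det_eq_0[of i "Suc n" j z] by simp
next
  case True
  define c where "c \<sigma> = of_int (sign \<sigma>) * (\<Prod>i<n. z i ^ \<sigma> i)" for \<sigma> :: "nat \<Rightarrow> nat"
  define q where "q = (\<Sum>\<sigma> | \<sigma> permutes {..<Suc n}. monom (c \<sigma>) (\<sigma> n))"
  have poly_q: "poly q w = vandermonde_det (Suc n) (z(n := w))" for w
    unfolding q_def vandermonde_det_def c_def poly_sum poly_monom
    by (intro sum.cong refl) (simp add: mult.assoc)
  have stab: "{\<sigma>. \<sigma> permutes {..<Suc n} \<and> \<sigma> n = n} = {\<sigma>. \<sigma> permutes {..<n}}"
    by (auto simp: permutes_def less_Suc_eq)
  have "coeff q n = (\<Sum>\<sigma> | \<sigma> permutes {..<Suc n}. if \<sigma> n = n then c \<sigma> else 0)"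
    unfolding q_def coeff_sum by simp
  also have "\<dots> = (\<Sum>\<sigma> | \<sigma> permutes {..<Suc n} \<and> \<sigma> n = n. c \<sigma>)"
    by (subst sum.inter_filter[symmetric]) (auto simp: finite_permutations)
  finally have coeff_n: "coeff q n = vandermonde_det n z"
    by (simp add: stab vandermonde_det_def c_def)
  have deg_q: "degree q \<le> n"
    unfolding q_def
  proof (rule degree_sum_le)
    show "finite {\<sigma>. \<sigma> permutes {..<Suc n}}" by (simp add: finite_permutations)
    fix \<sigma> assume "\<sigma> \<in> {\<sigma>. \<sigma> permutes {..<Suc n}}"
    then have "\<sigma> n \<in> {..<Suc n}" using permutes_in_image[of \<sigma> "{..<Suc n}" n] by simp
    then show "degree (monom (c \<sigma>) (\<sigma> n)) \<le> n" by (intro order.trans[OF degree_monom_le]) simp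
  qed
  define r where "r = (\<Prod>i<n. [:- z i, 1:])"
  have r: "degree r = n" "coeff r n = 1"
    using lead_coeff_prod[of "\<lambda>i. [:- z i, 1:]" "{..<n}"]
    by (simp_all add: r_def degree_prod_sum_eq)
  have "q = smult (vandermonde_det n z) r"
  proof (rule poly_eqI_degree_lead_coeff[where A = "z ` {..<n}" and n = n])
    fix x assume "x \<in> z ` {..<n}"
    then obtain i where i: "i < n" "x = z i" by auto
    have "poly q x = 0" unfolding poly_q
      by (rule vandermonde_det_eq_0[of i _ n]) (use i in auto)
    moreover have "poly r x = 0" using i by (auto simp: r_def poly_prod)
    ultimately show "poly q x = poly (smult (vandermonde_det n z) r) x" by simp
  qed (use deg_q r True in \<open>auto simp: coeff_n card_image intro: order.trans[OF degree_smult_le]\<close>)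
  then have "poly q (z n) = vandermonde_det n z * poly r (z n)" by simp
  then show ?thesis unfolding poly_q by (simp add: r_def poly_prod)
qed

text \<open>
  Squaring turns the product over unordered pairs into one over ordered pairs, which is the
  form of the logarithmic energy.
\<close>

lemma norm_vandermonde_det_squared:
  "(cmod (vandermonde_det n z))\<^sup>2 = (\<Prod>i<n. \<Prod>j\<in>{..<n} - {i}. cmod (z i - z j))"
proof (induction n)
  case 0
  then show ?case by (simp add: vandermonde_det_def)
next
  case (Suc n)
  have "(\<Prod>i<Suc n. \<Prod>j\<in>{..<Suc n} - {i}. cmod (z i - z j))
      = (\<Prod>i<n. (\<Prod>j\<in>{..<n} - {i}. cmod (z i - z j)) * cmod (z i - z n)) * (\<Prod>j<n. cmod (z n - z j))"
  proof -
    have "{..<Suc n} - {i} = insert n ({..<n} - {i})" if "i < n" for i using that by auto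
    moreover have "{..<Suc n} - {n} = {..<n}" by auto
    ultimately show ?thesis by (simp add: mult.commute)
  qed
  also have "\<dots> = (cmod (vandermonde_det n z))\<^sup>2 * (\<Prod>j<n. cmod (z n - z j))\<^sup>2"
    unfolding prod.distrib Suc.IH[symmetric] by (simp add: power2_eq_square norm_minus_commute)
  finally show ?case
    by (simp add: vandermonde_det_Suc norm_mult power_mult_distrib prod_norm[symmetric])
qed

section \<open>Configurations of low energy\<close>

text \<open>
  The maximum is at least the mean.  Expand the squared determinant by the Leibniz formula and average
  over all choices of \<open>N\<close> points of \<open>X\<close>: by orthogonality only the diagonal pairs of
  permutations survive, and there are \<open>N!\<close> of them.  This factor is what makes the resulting
  points repel each other well enough.
\<close>

lemma exists_large_det:
  fixes \<phi> :: "nat \<Rightarrow> 'x \<Rightarrow> complex" and h :: "nat \<Rightarrow> real"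
  assumes fin: "finite X" and ne: "X \<noteq> {}"
    and orth: "\<And>k l. k < N \<Longrightarrow> l < N \<Longrightarrow>
                 (\<Sum>v\<in>X. \<phi> k v * cnj (\<phi> l v)) = (if k = l then of_real (h k) else 0)"
  obtains f where "\<And>i. i < N \<Longrightarrow> f i \<in> X"
    "fact N * (\<Prod>k<N. h k / real (card X))
       \<le> (cmod (\<Sum>\<sigma> | \<sigma> permutes {..<N}. of_int (sign \<sigma>) * (\<Prod>i<N. \<phi> (\<sigma> i) (f i))))\<^sup>2"
proof -
  define P where "P = {\<sigma>. \<sigma> permutes {..<N}}"
  define D where "D f = (\<Sum>\<sigma>\<in>P. of_int (sign \<sigma>) * (\<Prod>i<N. \<phi> (\<sigma> i) (f i)))" for f
  define F where "F = PiE {..<N} (\<lambda>_. X)"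
  have finF: "finite F" unfolding F_def by (intro finite_PiE) (use fin in auto)
  have finP: "finite P" unfolding P_def by (simp add: finite_permutations)
  have "complex_of_real (\<Sum>f\<in>F. (cmod (D f))\<^sup>2) = (\<Sum>f\<in>F. D f * cnj (D f))"
    by (simp only: of_real_sum complex_norm_square)
  also have "\<dots> = (\<Sum>f\<in>F. \<Sum>\<sigma>\<in>P. \<Sum>\<tau>\<in>P. of_int (sign \<sigma> * sign \<tau>) *
      (\<Prod>i<N. \<phi> (\<sigma> i) (f i) * cnj (\<phi> (\<tau> i) (f i))))"
    unfolding D_def cnj_sum sum_product by (intro sum.cong refl) (simp add: prod.distrib mult_ac)
  also have "\<dots> = (\<Sum>\<sigma>\<in>P. \<Sum>f\<in>F. \<Sum>\<tau>\<in>P. of_int (sign \<sigma> * sign \<tau>) *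
      (\<Prod>i<N. \<phi> (\<sigma> i) (f i) * cnj (\<phi> (\<tau> i) (f i))))"
    by (rule sum.swap)
  also have "\<dots> = (\<Sum>\<sigma>\<in>P. \<Sum>\<tau>\<in>P. \<Sum>f\<in>F. of_int (sign \<sigma> * sign \<tau>) *
      (\<Prod>i<N. \<phi> (\<sigma> i) (f i) * cnj (\<phi> (\<tau> i) (f i))))"
    by (intro sum.cong refl sum.swap)
  also have "\<dots> = (\<Sum>\<sigma>\<in>P. \<Sum>\<tau>\<in>P. of_int (sign \<sigma> * sign \<tau>) *
      (\<Prod>i<N. \<Sum>v\<in>X. \<phi> (\<sigma> i) v * cnj (\<phi> (\<tau> i) v)))"
    unfolding sum_distrib_left[symmetric] F_def
    by (simp add: prod_sum_PiE fin)
  also have "\<dots> = (\<Sum>\<sigma>\<in>P. \<Sum>\<tau>\<in>P. if \<tau> = \<sigma> then of_real (\<Prod>k<N. h k) else 0)"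
  proof (intro sum.cong refl)
    fix \<sigma> \<tau> assume "\<sigma> \<in> P" "\<tau> \<in> P"
    then have \<sigma>: "\<sigma> permutes {..<N}" and \<tau>: "\<tau> permutes {..<N}" by (auto simp: P_def)
    have lt: "\<sigma> i < N" "\<tau> i < N" if "i < N" for i
      using permutes_in_image[OF \<sigma>, of i] permutes_in_image[OF \<tau>, of i] that by auto
    have "(\<Prod>i<N. \<Sum>v\<in>X. \<phi> (\<sigma> i) v * cnj (\<phi> (\<tau> i) v))
        = (\<Prod>i<N. if \<sigma> i = \<tau> i then of_real (h (\<sigma> i)) else 0)"
      by (intro prod.cong refl orth) (use lt in auto)
    also have "\<dots> = (if \<tau> = \<sigma> then of_real (\<Prod>i<N. h (\<sigma> i)) else 0)"
    proof (cases "\<tau> = \<sigma>")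
      case False
      then obtain i where "i < N" "\<sigma> i \<noteq> \<tau> i"
        using \<sigma> \<tau> by (metis ext permutes_not_in lessThan_iff)
      then show ?thesis using False by (auto intro!: prod_zero)
    qed simp
    also have "(\<Prod>i<N. h (\<sigma> i)) = (\<Prod>k<N. h k)"
      using prod.permute[OF \<sigma>, of h] by (simp add: o_def)
    finally show "of_int (sign \<sigma> * sign \<tau>) * (\<Prod>i<N. \<Sum>v\<in>X. \<phi> (\<sigma> i) v * cnj (\<phi> (\<tau> i) v))
        = (if \<tau> = \<sigma> then of_real (\<Prod>k<N. h k) else (0::complex))"
      using sign_idempotent[of \<sigma>] by (auto simp flip: of_int_mult)
  qed
  also have "\<dots> = of_real (fact N * (\<Prod>k<N. h k))"
    using finP by (simp add: P_def card_permutations[of "{..<N}" N])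
  finally have total: "(\<Sum>f\<in>F. (cmod (D f))\<^sup>2) = fact N * (\<Prod>k<N. h k)"
    using of_real_eq_iff by blast
  have cardF: "card F = card X ^ N" unfolding F_def by (simp add: card_PiE)
  have cX: "real (card X) > 0" using fin ne by (simp add: card_gt_0_iff)
  have "\<exists>f\<in>F. fact N * (\<Prod>k<N. h k / real (card X)) \<le> (cmod (D f))\<^sup>2"
  proof (rule ccontr)
    assume "\<not> ?thesis"
    then have "(\<Sum>f\<in>F. (cmod (D f))\<^sup>2) < (\<Sum>f\<in>F. fact N * (\<Prod>k<N. h k / real (card X)))"
      using finF ne by (intro sum_strict_mono) (auto simp: F_def PiE_eq_empty_iff)
    also have "\<dots> = fact N * (\<Prod>k<N. h k)"
      using cX by (simp add: cardF prod_dividef)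
    finally show False using total by simp
  qed
  then obtain f where "f \<in> F" "fact N * (\<Prod>k<N. h k / real (card X)) \<le> (cmod (D f))\<^sup>2" by blast
  then show thesis using that[of f] by (auto simp: F_def D_def P_def)
qed

lemma sum_choose_mult_choose:
  "(\<Sum>a\<le>m. (a choose k) * ((m - a) choose l)) = Suc m choose Suc (k + l)"
proof (induction m arbitrary: l)
  case 0
  then show ?case by (cases k; cases l) auto
next
  case (Suc m)
  show ?case
  proof (cases l)
    case 0
    then show ?thesis using sum_choose_upper[of k "Suc m"] by simp
  next
    case (Suc l')
    have "(\<Sum>a\<le>Suc m. (a choose k) * ((Suc m - a) choose l))
        = (\<Sum>a\<le>m. (a choose k) * ((Suc m - a) choose l))" using Suc by simp
    also have "\<dots> = (\<Sum>a\<le>m. (a choose k) * ((m - a) choose l') + (a choose k) * ((m - a) choose l))"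
      by (intro sum.cong refl) (simp add: Suc Suc_diff_le algebra_simps)
    also have "\<dots> = Suc (Suc m) choose Suc (k + l)"
      unfolding sum.distrib Suc.IH by (simp add: Suc)
    finally show ?thesis .
  qed
qed

lemma sum_roots_of_unity_powers:
  assumes "k < N" "l < N"
  shows "(\<Sum>b<N. cis (2 * pi * real b / real N) ^ k * cnj (cis (2 * pi * real b / real N) ^ l))
           = (if k = l then of_nat N else 0)"
proof (cases "k = l")
  case True
  have "cis a ^ l * cnj (cis a ^ l) = 1" for a
    using complex_norm_square[of "cis a ^ l"] by (simp add: norm_power)
  then show ?thesis unfolding True by (simp only: sum_constant) simp
next
  case False
  define x where "x = cis (2 * pi * (real k - real l) / real N)"
  have N: "real N > 0" using assms by simp
  have "cis (2 * pi * real b / real N) ^ k * cnj (cis (2 * pi * real b / real N) ^ l) = x ^ b" for b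
  proof -
    define \<theta> where "\<theta> = 2 * pi * real b / real N"
    have "cis \<theta> ^ k * cnj (cis \<theta> ^ l) = cis (real k * \<theta> + - (real l * \<theta>))"
      by (simp only: Complex.DeMoivre cis_cnj cis_mult)
    also have "real k * \<theta> + - (real l * \<theta>) = real b * (2 * pi * (real k - real l) / real N)"
      using N by (simp add: \<theta>_def field_simps)
    also have "cis \<dots> = x ^ b" by (simp only: x_def Complex.DeMoivre)
    finally show ?thesis by (simp only: \<theta>_def)
  qed
  moreover have "x ^ N = 1"
  proof -
    have "x ^ N = cis (2 * pi * of_int (int k - int l))"
      unfolding x_def Complex.DeMoivre using N by (simp add: mult_ac)
    then show ?thesis by (simp only: cis_multiple_2pi Ints_of_int)
  qed
  moreover have "x \<noteq> 1"
  proof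
    assume "x = 1"
    then have "cos (2 * pi * (real k - real l) / real N) = 1"
      unfolding x_def by (metis cis.simps(1) one_complex.simps(1))
    then obtain m where m: "2 * pi * (real k - real l) / real N = of_int m * 2 * pi"
      unfolding cos_one_2pi_int by blast
    have "2 * pi * ((real k - real l) / real N) = 2 * pi * of_int m"
      using m by (simp only: times_divide_eq_right mult_ac)
    then have "(real k - real l) / real N = of_int m"
      by (metis mult_cancel_left mult_eq_0_iff pi_neq_zero zero_neq_numeral)
    then have "real k - real l = of_int m * real N" using N by (simp only: divide_eq_eq split: if_splits)
    then have kl: "int k - int l = m * int N"
      by (metis of_int_diff of_int_eq_iff of_int_mult of_int_of_nat_eq)
    have "m = 0"
    proof (rule ccontr)
      assume "m \<noteq> 0"
      then have "1 * int N \<le> \<bar>m\<bar> * int N" by (intro mult_right_mono) auto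
      then have "int N \<le> \<bar>int k - int l\<bar>" unfolding kl by (simp add: abs_mult)
      then show False using assms by linarith
    qed
    then show False using kl False by simp
  qed
  ultimately show ?thesis using False by (simp add: geometric_sum)
qed

text \<open>
  The product \<open>(1 - 0 / R) \<dots> (1 - (N - 1) / R)\<close>, written with a binomial coefficient: it measures the loss caused by
  replacing an integral over the latitudes by a sum over \<open>R\<close> of them.
\<close>

lemma prod_one_minus_ge:
  assumes "N \<le> R" "R > 0"
  shows "(real (R choose N)) * fact N / real R ^ N \<ge> 1 - (real N)\<^sup>2 / real R"
  using assms(1)
proof (induction N)
  case 0
  then show ?case by simp
next
  case (Suc N)
  have "real (R choose Suc N) * fact (Suc N) = real (Suc N * (R choose Suc N)) * fact N"
    by (simp only: fact_Suc of_nat_mult mult_ac)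
  also have "Suc N * (R choose Suc N) = (R - N) * (R choose N)"
    by (metis binomial_absorb_comp Suc_times_binomial_eq binomial_absorption mult.commute
      diff_Suc_1 Suc_diff_le)
  finally have step: "real (R choose Suc N) * fact (Suc N) / real R ^ Suc N
      = (real (R choose N) * fact N / real R ^ N) * (1 - real N / real R)"
    using Suc.prems assms(2) by (simp add: of_nat_diff field_simps)
  have a: "1 - real N / real R \<ge> 0" "1 - real N / real R \<le> 1" using Suc.prems assms(2) by auto
  have "1 - (real (Suc N))\<^sup>2 / real R \<le> 1 - (real N)\<^sup>2 / real R - real N / real R"
    using assms(2) by (simp add: field_simps power2_eq_square)
  also have "\<dots> \<le> 1 - (real N)\<^sup>2 / real R - real N / real R + (real N)\<^sup>2 / real R * (real N / real R)"
    by simp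
  also have "\<dots> = (1 - (real N)\<^sup>2 / real R) * (1 - real N / real R)"
    by (simp only: left_diff_distrib right_diff_distrib)
  also have "\<dots> \<le> (real (R choose N) * fact N / real R ^ N) * (1 - real N / real R)"
    using Suc a by (intro mult_right_mono) auto
  finally show ?case unfolding step .
qed

lemma fact_mult_choose_le_power:
  "fact k * real (a choose k) \<le> real a ^ k"
  using binomial_fact_pow[of a k] by (metis mult.commute of_nat_fact of_nat_le_iff of_nat_mult of_nat_power)

text \<open>
  The points are chosen on a grid of latitudes and longitudes, on which the functions
  \<open>x ^ (n - k) * y ^ k\<close>, homogeneous of degree \<open>n = N - 1\<close> in the spinor, are orthogonal: different \<open>k\<close> are separated by the
  longitudes alone.  Their squared norms are discrete Beta integrals; replacing powers by falling
  factorials, they are evaluated with the convolution of binomial coefficients above.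
\<close>

lemma exists_low_energy:
  assumes N: "N \<ge> 1"
  obtains p where "p ` {1..N} \<subseteq> sphere 0 1" "inj_on p {1..N}"
    "log_energy N p \<le> - real N * (real N - 1) * ln 2 - ln (fact N) + real N * ln (10 / 9)
        + real N * ln (real N) + (\<Sum>k<N. ln (real (N - 1 choose k)))"
proof -
  define n where "n = N - 1"
  \<comment> \<open>By the product estimate above, a multiple of \<open>N\<^sup>2\<close> keeps the loss per function bounded; the factor 10
    makes it \<open>9 / 10\<close>.\<close>
  define R where "R = 10 * N\<^sup>2"
  have R: "R > 0" "N \<le> R" using N by (auto simp: R_def power2_eq_square)
  \<comment> \<open>The area below a latitude is proportional to \<open>t\<close>, so equidistant values of \<open>t\<close> sample the
    sphere uniformly.  They stop short of \<open>t = 1\<close>, which keeps \<open>z = y / x\<close> finite.\<close>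
  define t where "t a = real a / real R" for a :: nat
  have t: "0 \<le> t a" "t a < 1" if "a < R" for a using that by (auto simp: t_def)
  define X where "X = {..<R} \<times> {..<N}"
  define \<omega> where "\<omega> b = cis (2 * pi * real b / real N)" for b :: nat
  define x where "x v = sqrt (1 - t (fst v))" for v :: "nat \<times> nat"
  define y where "y v = of_real (sqrt (t (fst v))) * \<omega> (snd v)" for v :: "nat \<times> nat"
  define \<phi> where "\<phi> k v = of_real (x v) ^ (n - k) * y v ^ k" for k v
  define h where "h k = real N * (\<Sum>a<R. (1 - t a) ^ (n - k) * t a ^ k)" for k
  have finX: "finite X" and cardX: "real (card X) = real R * real N"
    by (auto simp: X_def)
  have "(0, 0) \<in> X" using R N by (auto simp: X_def)
  then have neX: "X \<noteq> {}" by blast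
  have orth: "(\<Sum>v\<in>X. \<phi> k v * cnj (\<phi> l v)) = (if k = l then of_real (h k) else 0)"
    if kl: "k < N" "l < N" for k l
  proof -
    define q where "q a = of_real (sqrt (1 - t a)) ^ (n - k) * of_real (sqrt (1 - t a)) ^ (n - l)
      * of_real (sqrt (t a)) ^ k * (of_real (sqrt (t a)) ^ l :: complex)" for a
    have "(\<Sum>v\<in>X. \<phi> k v * cnj (\<phi> l v)) = (\<Sum>a<R. \<Sum>b<N. q a * (\<omega> b ^ k * cnj (\<omega> b ^ l)))"
      unfolding X_def sum.cartesian_product' \<phi>_def x_def y_def q_def
      by (simp add: power_mult_distrib mult_ac)
    also have "\<dots> = (\<Sum>a<R. q a) * (if k = l then of_nat N else 0)"
      unfolding sum_distrib_left[symmetric] \<omega>_def sum_roots_of_unity_powers[OF kl]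
      by (simp add: sum_distrib_right)
    also have "\<dots> = (if k = l then of_real (h k) else 0)"
    proof (cases "k = l")
      case True
      have "q a = of_real ((1 - t a) ^ (n - k) * t a ^ k)" if "a < R" for a
      proof -
        have "q a = of_real ((sqrt (1 - t a) * sqrt (1 - t a)) ^ (n - k) * (sqrt (t a) * sqrt (t a)) ^ k)"
          unfolding q_def power_mult_distrib by (simp add: True mult_ac)
        then show ?thesis using t[OF that] by simp
      qed
      then show ?thesis using True by (simp add: h_def mult.commute)
    qed simp
    finally show ?thesis .
  qed
  obtain f where f: "\<And>i. i < N \<Longrightarrow> f i \<in> X"
    and big: "fact N * (\<Prod>k<N. h k / real (card X))
       \<le> (cmod (\<Sum>\<sigma> | \<sigma> permutes {..<N}. of_int (sign \<sigma>) * (\<Prod>i<N. \<phi> (\<sigma> i) (f i))))\<^sup>2"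
    using exists_large_det[of X N \<phi> h, OF finX neX orth] by blast
  have xpos: "x (f i) > 0" if "i < N" for i
    using f[OF that] t by (auto simp: x_def X_def)
  define z where "z i = y (f i) / of_real (x (f i))" for i
  have "(\<Sum>\<sigma> | \<sigma> permutes {..<N}. of_int (sign \<sigma>) * (\<Prod>i<N. \<phi> (\<sigma> i) (f i)))
      = (\<Prod>i<N. of_real (x (f i)) ^ n) * vandermonde_det N z"
  proof -
    have "(\<Prod>i<N. \<phi> (\<sigma> i) (f i)) = (\<Prod>i<N. of_real (x (f i)) ^ n) * (\<Prod>i<N. z i ^ \<sigma> i)"
      if "\<sigma> permutes {..<N}" for \<sigma>
    proof -
      have "\<phi> (\<sigma> i) (f i) = of_real (x (f i)) ^ n * z i ^ \<sigma> i" if "i < N" for i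
      proof -
        have "\<sigma> i \<le> n" using permutes_in_image[OF \<open>\<sigma> permutes {..<N}\<close>, of i] that by (auto simp: n_def)
        then have "of_real (x (f i)) ^ n = of_real (x (f i)) ^ (n - \<sigma> i) * (of_real (x (f i)) ^ \<sigma> i :: complex)"
          by (simp flip: power_add)
        then show ?thesis using xpos[OF that] by (simp add: \<phi>_def z_def power_divide)
      qed
      then show ?thesis by (simp add: prod.distrib)
    qed
    then show ?thesis unfolding vandermonde_det_def sum_distrib_left
      by (intro sum.cong refl) (simp add: mult_ac)
  qed
  then have "(cmod (\<Sum>\<sigma> | \<sigma> permutes {..<N}. of_int (sign \<sigma>) * (\<Prod>i<N. \<phi> (\<sigma> i) (f i))))\<^sup>2
      = (\<Prod>i<N. x (f i) ^ n)\<^sup>2 * (\<Prod>i<N. \<Prod>j\<in>{..<N} - {i}. cmod (z i - z j))"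
    using xpos by (simp add: norm_mult power_mult_distrib norm_vandermonde_det_squared
      prod_norm[symmetric] norm_power less_imp_le)
  also have "(\<Prod>i<N. x (f i) ^ n)\<^sup>2 = (\<Prod>i<N. \<Prod>j\<in>{..<N} - {i}. x (f i) * x (f j))"
  proof -
    have "(\<Prod>i<N. \<Prod>j\<in>{..<N} - {i}. x (f i)) = (\<Prod>i<N. x (f i) ^ n)"
      by (intro prod.cong refl) (simp add: n_def)
    moreover have "(\<Prod>i<N. \<Prod>j\<in>{..<N} - {i}. x (f j)) = (\<Prod>i<N. \<Prod>j\<in>{..<N} - {i}. x (f i))"
    proof -
      have "(\<Prod>i<N. \<Prod>j\<in>{..<N} - {i}. x (f j)) = (\<Prod>i<N. \<Prod>j | j < N \<and> i \<noteq> j. x (f j))"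
        by (intro prod.cong refl) auto
      also have "\<dots> = (\<Prod>j<N. \<Prod>i | i < N \<and> i \<noteq> j. x (f j))"
        using prod.swap_restrict[of "{..<N}" "{..<N}" "\<lambda>i j. x (f j)" "\<lambda>i j. i \<noteq> j"] by simp
      also have "\<dots> = (\<Prod>i<N. \<Prod>j\<in>{..<N} - {i}. x (f i))"
        by (intro prod.cong refl) auto
      finally show ?thesis .
    qed
    ultimately show ?thesis by (simp add: prod.distrib power2_eq_square)
  qed
  finally have det: "(cmod (\<Sum>\<sigma> | \<sigma> permutes {..<N}. of_int (sign \<sigma>) * (\<Prod>i<N. \<phi> (\<sigma> i) (f i))))\<^sup>2
      = (\<Prod>i<N. \<Prod>j\<in>{..<N} - {i}. x (f i) * x (f j) * cmod (z i - z j))"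
    by (simp add: prod.distrib)
  define q where "q i = sphere_pt (of_real (x (f i))) (y (f i))" for i
  have unit: "(cmod (of_real (x (f i))))\<^sup>2 + (cmod (y (f i)))\<^sup>2 = 1" if "i < N" for i
    using f[OF that] t by (auto simp: x_def y_def X_def \<omega>_def norm_mult less_imp_le)
  have dist_q: "norm (q i - q j) = 2 * (x (f i) * x (f j) * cmod (z i - z j))" if "i < N" "j < N" for i j
  proof -
    have "of_real (x (f i)) * y (f j) - y (f i) * of_real (x (f j))
        = of_real (x (f i)) * of_real (x (f j)) * (z j - z i)"
      using xpos[OF that(1)] xpos[OF that(2)] by (simp add: z_def field_simps)
    then show ?thesis
      unfolding q_def dist_sphere_pt[OF unit[OF that(1)] unit[OF that(2)]]
      using xpos[OF that(1)] xpos[OF that(2)] by (simp add: norm_mult norm_minus_commute)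
  qed
  have h_ge: "h k / real (card X) \<ge> (9 / 10) / (real N * real (n choose k))" if "k < N" for k
  proof -
    have kn: "k \<le> n" using that by (simp add: n_def)
    have "(\<Sum>a<R. (1 - t a) ^ (n - k) * t a ^ k) * real R ^ n
        = (\<Sum>a<R. real (R - a) ^ (n - k) * real a ^ k)"
      unfolding sum_distrib_right
    proof (intro sum.cong refl)
      fix a assume "a \<in> {..<R}"
      then have "1 - t a = real (R - a) / real R" using R by (simp add: t_def of_nat_diff field_simps)
      moreover have "real R ^ n = real R ^ (n - k) * real R ^ k" using kn by (simp flip: power_add)
      ultimately show "(1 - t a) ^ (n - k) * t a ^ k * real R ^ n = real (R - a) ^ (n - k) * real a ^ k"
        using R by (simp add: t_def power_divide)
    qed
    also have "\<dots> \<ge> (\<Sum>a<R. (fact (n - k) * real ((R - 1 - a) choose (n - k))) * (fact k * real (a choose k)))"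
    proof (intro sum_mono mult_mono)
      fix a assume "a \<in> {..<R}"
      have "fact (n - k) * real ((R - 1 - a) choose (n - k)) \<le> real (R - 1 - a) ^ (n - k)"
        by (rule fact_mult_choose_le_power)
      also have "\<dots> \<le> real (R - a) ^ (n - k)" by (intro power_mono) auto
      finally show "fact (n - k) * real ((R - 1 - a) choose (n - k)) \<le> real (R - a) ^ (n - k)" .
    qed (auto intro: fact_mult_choose_le_power)
    also have "(\<Sum>a<R. (fact (n - k) * real ((R - 1 - a) choose (n - k))) * (fact k * real (a choose k)))
        = fact k * fact (n - k) * real (\<Sum>a\<le>R - 1. (a choose k) * ((R - 1 - a) choose (n - k)))"
    proof -
      have "{..<R} = {..R - 1}" using R by auto
      then show ?thesis by (simp add: sum_distrib_left mult_ac)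
    qed
    also have "(\<Sum>a\<le>R - 1. (a choose k) * ((R - 1 - a) choose (n - k))) = R choose N"
      using sum_choose_mult_choose[of k "R - 1" "n - k"] R N kn by (simp add: n_def)
    finally have "fact k * fact (n - k) * real (R choose N)
        \<le> (\<Sum>a<R. (1 - t a) ^ (n - k) * t a ^ k) * real R ^ n" .
    then have "fact k * fact (n - k) * real (R choose N) / (real R ^ n * real R)
        \<le> (\<Sum>a<R. (1 - t a) ^ (n - k) * t a ^ k) / real R"
      using R by (simp add: field_simps)
    also have "\<dots> = h k / real (card X)"
      using N by (simp add: h_def cardX)
    finally have le: "fact k * fact (n - k) * real (R choose N) / real R ^ N \<le> h k / real (card X)"
      using N by (simp add: n_def flip: power_Suc2)
    have "9 / 10 \<le> real (R choose N) * fact N / real R ^ N"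
      using prod_one_minus_ge[OF R(2,1)] N by (simp add: R_def)
    then have "(9 / 10) / (real N * real (n choose k))
        \<le> (real (R choose N) * fact N / real R ^ N) / (real N * real (n choose k))"
      using N by (intro divide_right_mono) auto
    also have "\<dots> = fact k * fact (n - k) * real (R choose N) / real R ^ N"
    proof -
      have "fact N = real N * fact n" using N by (cases N) (auto simp: n_def)
      moreover have "real (n choose k) = fact n / (fact k * fact (n - k))"
        using kn by (rule binomial_fact)
      ultimately have "fact N / (real N * real (n choose k)) = fact k * fact (n - k)"
        using N by simp
      then have "fact k * fact (n - k) * real (R choose N) / real R ^ N
          = fact N / (real N * real (n choose k)) * (real (R choose N) / real R ^ N)" by simp
      then show ?thesis by (simp add: mult_ac)
    qed
    finally show ?thesis using le by simp
  qed
  have cpos: "real (n choose k) > 0" if "k < N" for k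
    using that by (simp add: n_def)
  have lower: "fact N * (\<Prod>k<N. (9 / 10) / (real N * real (n choose k)))
      \<le> (\<Prod>i<N. \<Prod>j\<in>{..<N} - {i}. x (f i) * x (f j) * cmod (z i - z j))"
    unfolding det[symmetric]
    by (rule order.trans[OF mult_left_mono big], rule prod_mono) (use h_ge in auto)
  have lower_pos: "0 < fact N * (\<Prod>k<N. (9 / 10) / (real N * real (n choose k)))"
    using N cpos by (intro mult_pos_pos prod_pos) auto
  have nz: "x (f i) * x (f j) * cmod (z i - z j) > 0" if "i < N" "j \<in> {..<N} - {i}" for i j
  proof (rule ccontr)
    assume "\<not> ?thesis"
    then have zero: "x (f i) * x (f j) * cmod (z i - z j) = 0"
      using xpos[of i] xpos[of j] that by (smt (verit) mult_nonneg_nonneg norm_ge_zero DiffD1 lessThan_iff)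
    have "(\<Prod>j\<in>{..<N} - {i}. x (f i) * x (f j) * cmod (z i - z j)) = 0"
      by (subst prod_zero_iff) (simp, use zero that in blast)
    then have "(\<Prod>i<N. \<Prod>j\<in>{..<N} - {i}. x (f i) * x (f j) * cmod (z i - z j)) = 0"
      by (subst prod_zero_iff) (simp, use that in blast)
    then show False using lower lower_pos by linarith
  qed
  define p where "p i = q (i - 1)" for i :: nat
  have shift: "(\<Sum>i\<in>{1..N}. \<Sum>j\<in>{1..N} - {i}. g (i - 1) (j - 1)) = (\<Sum>i<N. \<Sum>j\<in>{..<N} - {i}. g i j)"
    for g :: "nat \<Rightarrow> nat \<Rightarrow> real"
  proof (rule sum.reindex_bij_witness[of _ Suc "\<lambda>i. i - 1"])
    fix i assume "i \<in> {1..N}"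
    then show "(\<Sum>j\<in>{..<N} - {i - 1}. g (i - 1) j) = (\<Sum>j\<in>{1..N} - {i}. g (i - 1) (j - 1))"
      by (intro sum.reindex_bij_witness[of _ "\<lambda>i. i - 1" Suc]) auto
  qed auto
  show thesis
  proof
    show "p ` {1..N} \<subseteq> sphere 0 1"
    proof
      fix u assume "u \<in> p ` {1..N}"
      then obtain k where k: "k \<in> {1..N}" "u = q (k - 1)" by (auto simp: p_def)
      define i where "i = k - 1"
      have i: "i < N" "u = q i" using k by (auto simp: i_def)
      have "(norm (q i))\<^sup>2 = 1" unfolding q_def norm_sphere_pt_squared unit[OF i(1)] by simp
      then have "norm (q i) = 1" using norm_ge_zero[of "q i"] power2_eq_1_iff[of "norm (q i)"] by linarith
      then show "u \<in> sphere 0 1" using i by simp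
    qed
    show "inj_on p {1..N}"
    proof (rule inj_onI, rule ccontr)
      fix i j assume ij: "i \<in> {1..N}" "j \<in> {1..N}" "p i = p j" "i \<noteq> j"
      then have a: "i - 1 < N" "j - 1 < N" "j - 1 \<in> {..<N} - {i - 1}" by auto
      have "norm (q (i - 1) - q (j - 1)) > 0"
        unfolding dist_q[OF a(1,2)] using nz[OF a(1,3)] by simp
      then show False using ij by (simp add: p_def)
    qed
    have "log_energy N p = (\<Sum>i<N. \<Sum>j\<in>{..<N} - {i}. ln (1 / norm (q i - q j)))"
      unfolding log_energy_def p_def by (rule shift)
    also have "\<dots> = (\<Sum>i<N. \<Sum>j\<in>{..<N} - {i}. - ln 2 - ln (x (f i) * x (f j) * cmod (z i - z j)))"
    proof (intro sum.cong refl)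
      fix i j assume "i \<in> {..<N}" "j \<in> {..<N} - {i}"
      then show "ln (1 / norm (q i - q j)) = - ln 2 - ln (x (f i) * x (f j) * cmod (z i - z j))"
        using nz[of i j] by (subst dist_q) (auto simp: ln_div ln_mult_pos)
    qed
    also have "\<dots> = - real N * (real N - 1) * ln 2
        - (\<Sum>i<N. \<Sum>j\<in>{..<N} - {i}. ln (x (f i) * x (f j) * cmod (z i - z j)))"
      using N by (simp add: sum_subtractf of_nat_diff)
    also have "(\<Sum>i<N. \<Sum>j\<in>{..<N} - {i}. ln (x (f i) * x (f j) * cmod (z i - z j)))
        = ln (\<Prod>i<N. \<Prod>j\<in>{..<N} - {i}. x (f i) * x (f j) * cmod (z i - z j))"
    proof -
      have "(\<Sum>j\<in>{..<N} - {i}. ln (x (f i) * x (f j) * cmod (z i - z j)))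
          = ln (\<Prod>j\<in>{..<N} - {i}. x (f i) * x (f j) * cmod (z i - z j))" if "i < N" for i
      proof (rule ln_prod[symmetric])
        fix j assume "j \<in> {..<N} - {i}"
        from nz[OF that this] show "x (f i) * x (f j) * cmod (z i - z j) \<noteq> 0" by (metis order_less_irrefl)
      qed simp
      moreover have "(\<Sum>i<N. ln (\<Prod>j\<in>{..<N} - {i}. x (f i) * x (f j) * cmod (z i - z j)))
          = ln (\<Prod>i<N. \<Prod>j\<in>{..<N} - {i}. x (f i) * x (f j) * cmod (z i - z j))"
      proof (rule ln_prod[symmetric])
        fix i assume "i \<in> {..<N}"
        then have "(\<Prod>j\<in>{..<N} - {i}. x (f i) * x (f j) * cmod (z i - z j)) > 0"
          by (intro prod_pos nz) simp_all
        then show "(\<Prod>j\<in>{..<N} - {i}. x (f i) * x (f j) * cmod (z i - z j)) \<noteq> 0" by (metis order_less_irrefl)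
      qed simp
      ultimately show ?thesis by simp
    qed
    also have "- real N * (real N - 1) * ln 2 - \<dots>
        \<le> - real N * (real N - 1) * ln 2 - ln (fact N * (\<Prod>k<N. (9 / 10) / (real N * real (n choose k))))"
      using lower lower_pos by simp
    also have "ln (fact N * (\<Prod>k<N. (9 / 10) / (real N * real (n choose k))))
        = ln (fact N) + (\<Sum>k<N. ln ((9 / 10) / (real N * real (n choose k))))"
    proof -
      have "0 < (\<Prod>k<N. (9 / 10) / (real N * real (n choose k)))" using N cpos by (intro prod_pos) auto
      moreover have "ln (\<Prod>k<N. (9 / 10) / (real N * real (n choose k)))
          = (\<Sum>k<N. ln ((9 / 10) / (real N * real (n choose k))))"
        using N by (intro ln_prod) (auto simp: n_def)
      ultimately show ?thesis by (simp add: ln_mult_pos)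
    qed
    also have "(\<Sum>k<N. ln ((9 / 10) / (real N * real (n choose k))))
        = (\<Sum>k<N. - ln (10 / 9) - ln (real N) - ln (real (n choose k)))"
    proof (intro sum.cong refl)
      fix k assume "k \<in> {..<N}"
      then show "ln ((9 / 10) / (real N * real (n choose k))) = - ln (10 / 9) - ln (real N) - ln (real (n choose k))"
        using N cpos[of k] by (simp add: ln_div ln_mult_pos)
    qed
    finally show "log_energy N p \<le> - real N * (real N - 1) * ln 2 - ln (fact N) + real N * ln (10 / 9)
        + real N * ln (real N) + (\<Sum>k<N. ln (real (N - 1 choose k)))"
      by (simp add: sum_subtractf sum.distrib n_def algebra_simps)
  qed
qed

section \<open>Gaussian vectors\<close>

lemma indep_vars_PiM_coordinates:
  assumes "finite I" "I \<noteq> {}" "\<And>i. i \<in> I \<Longrightarrow> prob_space (Q i)" "\<And>i. i \<in> I \<Longrightarrow> sets (Q i) = sets (borel :: real measure)"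
  shows "prob_space.indep_vars (PiM I Q) (\<lambda>_. borel :: real measure) (\<lambda>i \<omega>. \<omega> i) I"
proof -
  interpret P: prob_space "PiM I Q" by (intro prob_space_PiM) (use assms in auto)
  have rv: "(\<lambda>\<omega>. \<omega> i) \<in> measurable (PiM I Q) borel" if "i \<in> I" for i
  proof -
    have "(\<lambda>\<omega>. \<omega> i) \<in> measurable (PiM I Q) (Q i)" using that by (rule measurable_component_singleton)
    then show ?thesis using assms(4)[OF that] by (simp cong: measurable_cong_sets)
  qed
  have d: "distr (PiM I Q) borel (\<lambda>\<omega>. \<omega> i) = Q i" if "i \<in> I" for i
  proof -
    have "distr (PiM I Q) borel (\<lambda>\<omega>. \<omega> i) = distr (PiM I Q) (Q i) (\<lambda>\<omega>. \<omega> i)"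
      by (intro distr_cong) (use assms(4)[OF that] in auto)
    then show ?thesis using distr_PiM_component[of I Q i] assms(3) that by simp
  qed
  have "distr (PiM I Q) (PiM I (\<lambda>_. borel)) (\<lambda>x. \<lambda>i\<in>I. x i) = distr (PiM I Q) (PiM I Q) (\<lambda>x. x)"
    by (intro distr_cong sets_PiM_cong refl) (auto simp: assms(4) space_PiM PiE_def extensional_restrict)
  also have "\<dots> = PiM I (\<lambda>i. distr (PiM I Q) borel (\<lambda>\<omega>. \<omega> i))"
    by (simp add: distr_id d cong: PiM_cong)
  finally show ?thesis
    by (subst P.indep_vars_iff_distr_eq_PiM'[OF assms(2) rv]) auto
qed

definition gauss :: "nat \<Rightarrow> (nat \<Rightarrow> real) measure" where
  "gauss N = PiM {..N} (\<lambda>_. density lborel std_normal_density)"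

lemma prob_space_gauss: "prob_space (gauss N)"
  unfolding gauss_def by (intro prob_space_PiM prob_space_normal_density) simp

lemma measurable_gauss_coord: "k \<le> N \<Longrightarrow> (\<lambda>g. g k) \<in> borel_measurable (gauss N)"
proof -
  assume "k \<le> N"
  then have "(\<lambda>g. g k) \<in> measurable (gauss N) (density lborel std_normal_density)"
    unfolding gauss_def by (intro measurable_component_singleton) auto
  then show ?thesis by (simp cong: measurable_cong_sets)
qed

lemma distributed_gauss_coord:
  assumes "k \<le> N"
  shows "distributed (gauss N) lborel (\<lambda>g. g k) std_normal_density"
proof -
  have "distr (gauss N) lborel (\<lambda>g. g k) = distr (gauss N) (density lborel std_normal_density) (\<lambda>g. g k)"
    by (intro distr_cong) auto
  also have "\<dots> = density lborel std_normal_density"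
    unfolding gauss_def using assms by (intro distr_PiM_component prob_space_normal_density) auto
  finally show ?thesis
    unfolding distributed_def using measurable_gauss_coord[OF assms] by auto
qed

lemma distributed_gauss_linear:
  assumes "(\<Sum>k\<le>N. (u k)\<^sup>2) > 0"
  shows "distributed (gauss N) lborel (\<lambda>g. \<Sum>k\<le>N. g k * u k) (normal_density 0 (sqrt (\<Sum>k\<le>N. (u k)\<^sup>2)))"
proof -
  interpret P: prob_space "gauss N" by (rule prob_space_gauss)
  define I where "I = {k\<in>{..N}. u k \<noteq> 0}"
  have I: "finite I" "I \<noteq> {}" "I \<subseteq> {..N}"
  proof -
    show "I \<noteq> {}"
    proof
      assume "I = {}"
      then have "(\<Sum>k\<le>N. (u k)\<^sup>2) = 0" by (auto simp: I_def intro!: sum.neutral)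
      with assms show False by simp
    qed
  qed (auto simp: I_def)
  have "P.indep_vars (\<lambda>_. borel) (\<lambda>k g. g k) {..N}"
    unfolding gauss_def
    by (rule indep_vars_PiM_coordinates) (auto intro: prob_space_normal_density)
  then have "P.indep_vars (\<lambda>_. borel) (\<lambda>k g. g k) I" using I(3) by (rule P.indep_vars_subset)
  then have ind: "P.indep_vars (\<lambda>_. borel) (\<lambda>k g. 0 + u k * g k) I"
    by (rule P.indep_vars_compose2) auto
  have "distributed (gauss N) lborel (\<lambda>g. \<Sum>k\<in>I. 0 + u k * g k)
      (normal_density (\<Sum>k\<in>I. 0 + u k * 0) (sqrt (\<Sum>k\<in>I. (\<bar>u k\<bar> * 1)\<^sup>2)))"
  proof (rule P.sum_indep_normal[OF I(1,2) ind])
    fix k assume "k \<in> I"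
    then show "0 < \<bar>u k\<bar> * 1" by (simp add: I_def)
    from \<open>k \<in> I\<close> show "distributed (gauss N) lborel (\<lambda>g. 0 + u k * g k) (normal_density (0 + u k * 0) (\<bar>u k\<bar> * 1))"
      by (intro P.normal_density_affine distributed_gauss_coord) (auto simp: I_def)
  qed
  moreover have "(\<Sum>k\<in>I. 0 + u k * g k) = (\<Sum>k\<le>N. g k * u k)" for g :: "nat \<Rightarrow> real"
    using I(3) by (intro sum.mono_neutral_cong_left) (auto simp: I_def)
  moreover have "(\<Sum>k\<in>I. (\<bar>u k\<bar> * 1)\<^sup>2) = (\<Sum>k\<le>N. (u k)\<^sup>2)"
    using I(3) by (intro sum.mono_neutral_cong_left) (auto simp: I_def)
  ultimately show ?thesis by simp
qed

lemma AE_gauss_linear_nonzero: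
  assumes "(\<Sum>k\<le>N. (u k)\<^sup>2) > 0"
  shows "AE g in gauss N. (\<Sum>k\<le>N. g k * u k) \<noteq> 0"
proof -
  have "AE y in lborel. y \<noteq> (0::real)" by (rule AE_lborel_singleton)
  then have "AE y in density lborel (normal_density 0 (sqrt (\<Sum>k\<le>N. (u k)\<^sup>2))). y \<noteq> (0::real)"
    by (subst AE_density) auto
  then have "AE y in distr (gauss N) lborel (\<lambda>g. \<Sum>k\<le>N. g k * u k). y \<noteq> 0"
    using distributed_gauss_linear[OF assms] by (simp only: distributed_distr_eq_density)
  then show ?thesis
    using distributed_measurable[OF distributed_gauss_linear[OF assms]] by (rule AE_distrD[rotated])
qed

lemma nn_integral_neg_ln_square:
  "(\<integral>\<^sup>+ y. ennreal (max 0 (- ln (y\<^sup>2))) \<partial>lborel) = 4"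
proof -
  have pos: "((\<lambda>y. - 2 * ln y) has_integral 2) {0..1::real}"
  proof -
    have cont: "continuous_on {0..1} (\<lambda>y::real. 2 * (y - y * ln y))"
      unfolding continuous_on_eq_continuous_within
    proof
      fix x :: real assume x: "x \<in> {0..1}"
      show "continuous (at x within {0..1}) (\<lambda>y. 2 * (y - y * ln y))"
      proof (cases "x = 0")
        case True
        have "((\<lambda>y::real. y * ln y) \<longlongrightarrow> 0) (at_right 0)" by real_asymp
        then have "((\<lambda>y::real. 2 * (y - y * ln y)) \<longlongrightarrow> 2 * (0 - 0)) (at_right 0)"
          by (intro tendsto_intros)
        then have "((\<lambda>y::real. 2 * (y - y * ln y)) \<longlongrightarrow> 0) (at 0 within {0..1})"
          by (simp add: at_within_Icc_at_right)
        then show ?thesis by (simp add: True continuous_within)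
      next
        case False
        then show ?thesis using x by (intro continuous_intros) auto
      qed
    qed
    have "((\<lambda>y. - 2 * ln y) has_integral (2 * (1 - 1 * ln 1) - 2 * (0 - 0 * ln 0))) {0..1::real}"
    proof (rule fundamental_theorem_of_calculus_interior[OF _ cont])
      fix x :: real assume "x \<in> {0<..<1}"
      then show "((\<lambda>y. 2 * (y - y * ln y)) has_vector_derivative - 2 * ln x) (at x)"
        unfolding has_real_derivative_iff_has_vector_derivative[symmetric]
        by (auto intro!: derivative_eq_intros)
    qed simp
    then show ?thesis by simp
  qed
  let ?f = "\<lambda>y::real. max 0 (- ln (y\<^sup>2))"
  have pos': "(?f has_integral 2) {0..1}"
    by (rule has_integral_eq[OF _ pos]) (auto simp: ln_realpow power2_eq_square ln_mult max_def)
  have "(?f has_integral 2) {-1..0}"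
    using has_integral_reflect_real[THEN iffD2, of ?f 2 0 1] pos' by (simp add: has_integral_reflect_real)
  then have "(?f has_integral (2 + 2)) {-1..1}"
    using pos' by (intro has_integral_combine[of "-1" 0 1]) auto
  then have "(?f has_integral 4) {-1..1}" by simp
  then have "(?f has_integral 4) UNIV"
  proof (rule has_integral_on_superset)
    fix y :: real assume "y \<notin> {-1..1}"
    then have "y\<^sup>2 \<ge> 1" by (auto simp: abs_le_square_iff[of 1 y, simplified, symmetric])
    then show "?f y = 0" by simp
  qed auto
  then show ?thesis
    by (subst nn_integral_has_integral_lborel) auto
qed

text \<open>
  A linear form in Gaussian variables is Gaussian, so it is rarely small: its density is at
  most \<open>1 / sqrt pi\<close>, and \<open>- ln (y\<^sup>2)\<close> integrates to 4 over the interval where it is positive.  Only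
  the negative part of the logarithm is estimated, which avoids any question of integrability.
\<close>

lemma nn_integral_gauss_neg_ln_le:
  assumes "(\<Sum>k\<le>N. (u k)\<^sup>2) \<ge> 1 / 2"
  shows "(\<integral>\<^sup>+ g. ennreal (max 0 (- ln ((\<Sum>k\<le>N. g k * u k)\<^sup>2))) \<partial>gauss N) \<le> ennreal (4 / sqrt pi)"
proof -
  define s where "s = sqrt (\<Sum>k\<le>N. (u k)\<^sup>2)"
  have s: "s\<^sup>2 \<ge> 1 / 2" "s > 0" using assms by (auto simp: s_def)
  have dens: "normal_density 0 s y \<le> 1 / sqrt pi" for y
  proof -
    have "normal_density 0 s y \<le> 1 / sqrt (2 * pi * s\<^sup>2) * 1"
      unfolding normal_density_def by (intro mult_left_mono) auto
    also have "\<dots> \<le> 1 / sqrt pi"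
      using s by (auto intro!: divide_left_mono)
    finally show ?thesis .
  qed
  have "(\<integral>\<^sup>+ g. ennreal (max 0 (- ln ((\<Sum>k\<le>N. g k * u k)\<^sup>2))) \<partial>gauss N)
      = (\<integral>\<^sup>+ y. ennreal (normal_density 0 s y) * ennreal (max 0 (- ln (y\<^sup>2))) \<partial>lborel)"
    using distributed_nn_integral[OF distributed_gauss_linear[of u N], of "\<lambda>y. ennreal (max 0 (- ln (y\<^sup>2)))"] assms
    by (simp add: s_def)
  also have "\<dots> \<le> (\<integral>\<^sup>+ y. ennreal (1 / sqrt pi) * ennreal (max 0 (- ln (y\<^sup>2))) \<partial>lborel)"
    by (intro nn_integral_mono mult_right_mono ennreal_leI dens) auto
  also have "\<dots> = ennreal (1 / sqrt pi) * 4"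
    unfolding nn_integral_neg_ln_square[symmetric] by (rule nn_integral_cmult) measurable
  also have "\<dots> = ennreal (4 / sqrt pi)"
    by (simp add: ennreal_mult'[symmetric] flip: ennreal_numeral)
  finally show ?thesis .
qed

lemma nn_integral_gauss_square:
  assumes "k \<le> N"
  shows "(\<integral>\<^sup>+ g. ennreal ((g k)\<^sup>2) \<partial>gauss N) = 1"
proof -
  have "(\<integral>\<^sup>+ g. ennreal ((g k)\<^sup>2) \<partial>gauss N)
      = (\<integral>\<^sup>+ y. ennreal (std_normal_density y) * ennreal (y\<^sup>2) \<partial>lborel)"
    using distributed_nn_integral[OF distributed_gauss_coord[OF assms], of "\<lambda>y. ennreal (y\<^sup>2)"] by simp
  also have "\<dots> = (\<integral>\<^sup>+ y. ennreal (std_normal_density y * y\<^sup>2) \<partial>lborel)"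
    by (simp add: ennreal_mult')
  also have "\<dots> = ennreal (integral\<^sup>L lborel (\<lambda>y. std_normal_density y * y\<^sup>2))"
    using integrable_std_normal_moment[of 2] by (intro nn_integral_eq_integral) auto
  also have "\<dots> = 1" using integral_std_normal_moment_even[of 1] by simp
  finally show ?thesis .
qed

text \<open>
  The margin \<open>e\<close> replaces an argument about strict inequality of integrals.
\<close>

lemma (in prob_space) exists_le_nn_integral:
  assumes "AE x in M. P x" "(\<integral>\<^sup>+ x. ennreal (f x) \<partial>M) \<le> ennreal c" "e > 0" "c \<ge> 0"
  obtains x where "P x" "f x \<le> c + e"
proof (rule ccontr)
  assume "\<not> thesis"
  then have "\<And>x. P x \<Longrightarrow> f x > c + e" using that by (meson linorder_not_less)
  then have "AE x in M. ennreal (c + e) \<le> ennreal (f x)"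
    using assms(1) by (auto elim!: eventually_mono intro!: ennreal_leI simp: less_imp_le)
  then have "(\<integral>\<^sup>+ x. ennreal (c + e) \<partial>M) \<le> (\<integral>\<^sup>+ x. ennreal (f x) \<partial>M)"
    by (rule nn_integral_mono_AE)
  then have "ennreal (c + e) \<le> ennreal c"
    using assms(2) by (simp add: emeasure_space_1)
  then show False using assms(3,4) by simp
qed

section \<open>Products of distances to a grid\<close>

lemma prod_minus_roots_of_unity:
  assumes "L > 0"
  shows "(\<Prod>b<L. w - cis (2 * pi * real b / real L)) = w ^ L - 1"
proof -
  define q where "q = (\<Prod>b<L. [:- cis (2 * pi * real b / real L), 1:])"
  have bij: "bij_betw (\<lambda>b. cis (2 * pi * real b / real L)) {..<L} {z. z ^ L = 1}"
    using assms by (rule Complex.bij_betw_roots_unity)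
  have degq: "degree q = L" "coeff q L = 1"
    using lead_coeff_prod[of "\<lambda>b. [:- cis (2 * pi * real b / real L), 1:]" "{..<L}"]
    by (simp_all add: q_def degree_prod_sum_eq)
  have "q = monom 1 L - 1"
  proof (rule poly_eqI_degree_lead_coeff[where A = "{z. z ^ L = 1}" and n = L])
    fix x :: complex assume x: "x \<in> {z. z ^ L = 1}"
    then obtain b where "b < L" "x = cis (2 * pi * real b / real L)"
      using bij_betw_imp_surj_on[OF bij] by (auto simp: image_iff)
    then have "poly q x = 0" by (auto simp: q_def poly_prod)
    then show "poly q x = poly (monom 1 L - 1) x" using x by (simp add: poly_monom)
  next
    show "degree (monom 1 L - 1 :: complex poly) \<le> L"
      by (intro degree_diff_le degree_monom_le) auto
  qed (use degq assms in \<open>auto simp: card_roots_unity_eq\<close>)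
  then have "poly q w = w ^ L - 1" by (simp add: poly_monom)
  then show ?thesis by (simp add: q_def poly_prod)
qed

text \<open>
  A discrete form, with an error factor 4, of the fact that the mean of \<open>ln (cmod (w - z))\<close> over the circle
  \<open>cmod w = s\<close> is \<open>ln (max s (cmod z))\<close>.
\<close>

lemma norm_prod_circle_le:
  assumes "L > 0" "s \<ge> 0"
  shows "(\<Prod>b<L. (cmod (of_real s * cis (2 * pi * real b / real L) - z))\<^sup>2)
           \<le> 4 * (max (s\<^sup>2) ((cmod z)\<^sup>2)) ^ L"
proof -
  have main: "(\<Prod>b<L. cmod (of_real s * cis (2 * pi * real b / real L) - z)) \<le> s ^ L + cmod z ^ L"
  proof (cases "s = 0")
    case True
    then show ?thesis by simp
  next
    case False
    have "cmod (of_real s * cis (2 * pi * real b / real L) - z)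
        = s * cmod (z / of_real s - cis (2 * pi * real b / real L))" for b
    proof -
      have "of_real s * cis (2 * pi * real b / real L) - z
          = - (of_real s * (z / of_real s - cis (2 * pi * real b / real L)))"
        using False by (simp add: field_simps)
      then show ?thesis using assms by (simp only: norm_minus_cancel norm_mult norm_of_real abs_of_nonneg)
    qed
    then have "(\<Prod>b<L. cmod (of_real s * cis (2 * pi * real b / real L) - z))
        = s ^ L * cmod ((z / of_real s) ^ L - 1)"
      by (simp add: prod.distrib prod_norm flip: prod_minus_roots_of_unity[OF assms(1)])
    also have "\<dots> = cmod (of_real s ^ L * ((z / of_real s) ^ L - 1))"
      using assms by (simp add: norm_mult norm_power)
    also have "of_real s ^ L * ((z / of_real s) ^ L - 1) = z ^ L - of_real s ^ L"
      using False by (simp add: field_simps)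
    also have "cmod \<dots> \<le> cmod z ^ L + s ^ L"
      using norm_triangle_ineq4[of "z ^ L" "of_real s ^ L"] assms by (simp add: norm_power)
    finally show ?thesis by simp
  qed
  have "(\<Prod>b<L. (cmod (of_real s * cis (2 * pi * real b / real L) - z))\<^sup>2)
      = (\<Prod>b<L. cmod (of_real s * cis (2 * pi * real b / real L) - z))\<^sup>2"
    by (simp add: prod_power_distrib)
  also have "\<dots> \<le> (s ^ L + cmod z ^ L)\<^sup>2"
    by (intro power_mono main prod_nonneg) auto
  also have "\<dots> \<le> (2 * max s (cmod z) ^ L)\<^sup>2"
  proof (intro power_mono)
    have "s ^ L \<le> max s (cmod z) ^ L" "cmod z ^ L \<le> max s (cmod z) ^ L"
      using assms by (auto intro!: power_mono)
    then show "s ^ L + cmod z ^ L \<le> 2 * max s (cmod z) ^ L" by linarith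
  qed (use assms in auto)
  also have "\<dots> = 4 * ((max s (cmod z))\<^sup>2) ^ L"
    by (simp add: power_mult_distrib power_mult[symmetric] mult.commute)
  also have "(max s (cmod z))\<^sup>2 = max (s\<^sup>2) ((cmod z)\<^sup>2)"
    using assms by (auto simp: max_def abs_le_square_iff[symmetric])
  finally show ?thesis .
qed

text \<open>
  Up to some index \<open>m\<close> the maximum is the second term, afterwards it is the first.  The product is
  therefore exactly \<open>fact q * (q choose m) * y ^ m\<close>, a single term of the binomial expansion of the right-hand
  side.
\<close>

lemma prod_max_le:
  fixes y :: real
  assumes "y \<ge> 0"
  shows "(\<Prod>j=1..q. max (real j) (y * real (Suc q - j))) \<le> fact q * (1 + y) ^ q"
proof -
  define A where "A = {j\<in>{1..q}. y * real (Suc q - j) > real j}"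
  define m where "m = Max (insert 0 A)"
  have finA: "finite (insert 0 A)" by (simp add: A_def)
  have mq: "m \<le> q" unfolding m_def using finA by (subst Max_le_iff) (auto simp: A_def)
  have big: "max (real j) (y * real (Suc q - j)) = y * real (Suc q - j)" if "j \<in> {1..m}" for j
  proof -
    have "m \<in> insert 0 A" unfolding m_def using finA by (rule Max_in) simp
    then have "m \<in> A" using that by auto
    then have "real j \<le> real m" "real m < y * real (Suc q - m)" using that by (auto simp: A_def)
    moreover have "y * real (Suc q - m) \<le> y * real (Suc q - j)"
      using that assms by (intro mult_left_mono) auto
    ultimately have "real j \<le> y * real (Suc q - j)" by linarith
    then show ?thesis by (rule max_absorb2)
  qed
  have small: "max (real j) (y * real (Suc q - j)) = real j" if "j \<in> {Suc m..q}" for j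
  proof -
    have "j \<notin> A"
    proof
      assume "j \<in> A"
      then have "j \<le> m" unfolding m_def using finA by (intro Max_ge) auto
      then show False using that by simp
    qed
    then show ?thesis using that by (auto simp: A_def)
  qed
  have up: "(\<Prod>j=1..m. real (Suc q - j)) * fact (q - m) = fact q" if "m \<le> q" for m
    using that
  proof (induction m)
    case (Suc m)
    have "fact (q - m) = real (q - m) * fact (q - Suc m)"
      using Suc.prems by (metis Suc_diff_Suc Suc_le_lessD fact_Suc)
    then show ?case using Suc by (simp add: mult_ac)
  qed simp
  have down: "fact m * (\<Prod>j=Suc m..q. real j) = fact q"
    using mq
  proof (induction q rule: dec_induct)
    case (step q)
    then show ?case by (simp add: mult_ac)
  qed simp
  have "(\<Prod>j=1..q. max (real j) (y * real (Suc q - j)))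
      = (\<Prod>j=1..m. max (real j) (y * real (Suc q - j))) * (\<Prod>j=Suc m..q. max (real j) (y * real (Suc q - j)))"
    using mq by (subst prod.union_disjoint[symmetric]) (auto intro!: prod.cong)
  also have "\<dots> = y ^ m * (\<Prod>j=1..m. real (Suc q - j)) * (\<Prod>j=Suc m..q. real j)"
    using big small by (simp add: prod.distrib)
  also have "\<dots> = fact q * (real (q choose m) * y ^ m)"
    using up[OF mq] down mq by (simp add: binomial_fact field_simps)
  also have "\<dots> \<le> fact q * (1 + y) ^ q"
  proof (intro mult_left_mono)
    have "real (q choose m) * y ^ m \<le> (\<Sum>k\<le>q. real (q choose k) * y ^ k)"
      using mq assms by (intro member_le_sum) auto
    also have "\<dots> = (1 + y) ^ q" by (subst add.commute) (simp add: binomial_ring)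
    finally show "real (q choose m) * y ^ m \<le> (1 + y) ^ q" .
  qed simp
  finally show ?thesis .
qed

text \<open>
  A weak form of Stirling's formula that is stable under the induction: the step is the inequality
  \<open>exp 1 \<le> (1 + 1 / J) ^ (J + 1)\<close>.
\<close>

lemma fact_le_power_exp:
  assumes "J \<ge> 1"
  shows "fact (J - 1) \<le> real J ^ J * exp (1 - real J)"
  using assms
proof (induction J rule: dec_induct)
  case (step J)
  have "1 / (real J + 1) \<le> ln (1 + 1 / real J)"
  proof -
    have "ln (real J / (real J + 1)) \<le> real J / (real J + 1) - 1"
      using step by (intro ln_le_minus_one) auto
    moreover have "ln (real J / (real J + 1)) = - ln (1 + 1 / real J)"
      using step by (simp add: ln_div[symmetric] ln_inverse[symmetric] field_simps)
    moreover have "real J / (real J + 1) - 1 = - (1 / (real J + 1))"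
      by (simp add: field_simps)
    ultimately show ?thesis by linarith
  qed
  then have "1 \<le> real (Suc J) * ln (1 + 1 / real J)"
    by (simp add: field_simps)
  then have "exp 1 \<le> exp (real (Suc J) * ln (1 + 1 / real J))" by simp
  also have "\<dots> = exp (ln (1 + 1 / real J)) ^ Suc J" by (rule exp_of_nat_mult)
  also have "exp (ln (1 + 1 / real J)) = 1 + 1 / real J" by (intro exp_ln) (simp add: add_pos_nonneg)
  finally have e: "exp 1 \<le> (1 + 1 / real J) ^ Suc J" .
  have "fact (Suc J - 1) = real J * fact (J - 1)" using step by (simp add: fact_reduce)
  also have "\<dots> \<le> real J * (real J ^ J * exp (1 - real J))"
    using step by (intro mult_left_mono) auto
  also have "\<dots> = real J ^ Suc J * exp (1 - real (Suc J)) * exp 1"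
    using mult_exp_exp[of "1 - real (Suc J)" 1] by (simp add: mult_ac)
  also have "\<dots> \<le> real J ^ Suc J * exp (1 - real (Suc J)) * (1 + 1 / real J) ^ Suc J"
    by (intro mult_left_mono e) auto
  also have "\<dots> = (real J * (1 + 1 / real J)) ^ Suc J * exp (1 - real (Suc J))"
    by (simp only: power_mult_distrib mult_ac)
  also have "real J * (1 + 1 / real J) = real (Suc J)" using step by (simp add: field_simps)
  finally show ?case .
qed simp

section \<open>The Bombieri-Weyl norm\<close>

lemma bw_norm_squared: "(bw_norm f)\<^sup>2 = (\<Sum>i\<le>degree f. (cmod (coeff f i))\<^sup>2 / real (degree f choose i))"
  unfolding bw_norm_def by (intro real_sqrt_pow2 sum_nonneg) auto

lemma bw_norm_nonneg: "bw_norm f \<ge> 0"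
  unfolding bw_norm_def by (intro real_sqrt_ge_zero sum_nonneg) auto

lemma bw_norm_linear: "bw_norm [:- z, 1:] = sqrt (1 + (cmod z)\<^sup>2)"
  by (simp add: bw_norm_def add.commute)

lemma bw_norm_smult: "bw_norm (smult a f) = cmod a * bw_norm f"
proof (cases "a = 0")
  case False
  then show ?thesis
    unfolding bw_norm_def
    by (simp add: norm_mult power_mult_distrib sum_distrib_left[symmetric] real_sqrt_mult
        flip: times_divide_eq_right)
qed (simp add: bw_norm_def)

lemma bw_norm_pos: "f \<noteq> 0 \<Longrightarrow> bw_norm f > 0"
proof -
  assume "f \<noteq> 0"
  then have "0 < (cmod (coeff f (degree f)))\<^sup>2 / real (degree f choose degree f)" by simp
  also have "\<dots> \<le> (bw_norm f)\<^sup>2" unfolding bw_norm_squared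
    by (rule member_le_sum[of _ _ "\<lambda>i. (cmod (coeff f i))\<^sup>2 / real (degree f choose i)"]) auto
  finally show ?thesis using bw_norm_nonneg[of f] by (auto simp: less_le)
qed

lemma complex_poly_splits:
  fixes p :: "complex poly"
  assumes "p \<noteq> 0"
  obtains z where "p = smult (lead_coeff p) (\<Prod>i=1..degree p. [:- z i, 1:])"
proof -
  obtain A where A: "size A = degree p" "p = smult (lead_coeff p) (\<Prod>x\<in>#A. [:-x, 1:])"
    using alg_closed_imp_factorization[OF assms] by blast
  obtain xs where xs: "mset xs = A" using ex_mset by blast
  have "(\<Prod>x\<in>#A. [:-x, 1:]) = prod_list (map (\<lambda>x. [:-x, 1:]) xs)"
    unfolding xs[symmetric] mset_map[symmetric] by (rule prod_mset_prod_list)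
  also have "\<dots> = (\<Prod>i=0..<length xs. [:- (xs ! i), 1:])"
    by (simp add: prod.list_conv_set_nth)
  also have "\<dots> = (\<Prod>i=1..degree p. [:- (xs ! (i - 1)), 1:])"
    using A(1) xs by (intro prod.reindex_bij_witness[of _ "\<lambda>i. i - 1" Suc]) auto
  finally show thesis using that[of "\<lambda>i. xs ! (i - 1)"] A(2) by simp
qed

section \<open>The logarithmic mean of a polynomial over the sphere\<close>

text \<open>
  The stereographic coordinates of a grid with \<open>J - 1\<close> latitudes and \<open>L\<close> longitudes.  The point
  with \<open>cmod w\<close> squared equal to \<open>j / (J - j)\<close> has height parameter \<open>j / J\<close>, so the latitudes cut the sphere into
  strips of equal area.
\<close>

definition node :: "nat \<Rightarrow> nat \<Rightarrow> nat \<times> nat \<Rightarrow> complex" where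
  "node J L v = of_real (sqrt (real (fst v) / real (J - fst v))) * cis (2 * pi * real (snd v) / real L)"

text \<open>
  In the limit of fine grids this says that the mean of \<open>ln ((cmod (w - z))\<^sup>2 / (1 + (cmod w)\<^sup>2))\<close> over the sphere is at most
  \<open>ln (1 + (cmod z)\<^sup>2) - 1\<close>.
\<close>

lemma prod_nodes_le:
  assumes L: "L > 0"
  shows "(\<Prod>j=1..q. \<Prod>b<L. (cmod (node (Suc q) L (j, b) - z))\<^sup>2 * (real (Suc q - j) / real (Suc q)))
           \<le> 4 ^ q * (fact q * (1 + (cmod z)\<^sup>2) ^ q / real (Suc q) ^ q) ^ L"
proof -
  let ?y = "(cmod z)\<^sup>2" and ?J = "Suc q"
  have "(\<Prod>j=1..q. \<Prod>b<L. (cmod (node ?J L (j, b) - z))\<^sup>2 * (real (?J - j) / real ?J))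
      \<le> (\<Prod>j=1..q. 4 * (max (real j) (?y * real (?J - j)) / real ?J) ^ L)"
  proof (rule prod_mono, intro conjI)
    fix j assume j: "j \<in> {1..q}"
    then have pos: "real (?J - j) > 0" by simp
    have "(\<Prod>b<L. (cmod (node ?J L (j, b) - z))\<^sup>2 * (real (?J - j) / real ?J))
        = (\<Prod>b<L. (cmod (node ?J L (j, b) - z))\<^sup>2) * (real (?J - j) / real ?J) ^ L"
      by (simp only: prod.distrib prod_constant card_lessThan)
    also have "\<dots> \<le> 4 * (max ((sqrt (real j / real (?J - j)))\<^sup>2) ?y) ^ L * (real (?J - j) / real ?J) ^ L"
      unfolding node_def fst_conv snd_conv
      by (intro mult_right_mono norm_prod_circle_le L) auto
    also have "\<dots> = 4 * (max (real j / real (?J - j)) ?y * (real (?J - j) / real ?J)) ^ L"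
    proof -
      have "(sqrt (real j / real (?J - j)))\<^sup>2 = real j / real (?J - j)" by simp
      then show ?thesis by (simp only: power_mult_distrib mult.assoc)
    qed
    also have "max (real j / real (?J - j)) ?y * (real (?J - j) / real ?J)
        = max (real j) (?y * real (?J - j)) / real ?J"
    proof -
      have "max (real j / real (?J - j)) ?y * real (?J - j) = max (real j / real (?J - j) * real (?J - j)) (?y * real (?J - j))"
        using pos by (intro max_mult_distrib_right[THEN trans]) simp
      then show ?thesis using pos by simp
    qed
    finally show "(\<Prod>b<L. (cmod (node ?J L (j, b) - z))\<^sup>2 * (real (?J - j) / real ?J))
        \<le> 4 * (max (real j) (?y * real (?J - j)) / real ?J) ^ L" .
  qed (auto intro!: prod_nonneg)
  also have "\<dots> = 4 ^ q * ((\<Prod>j=1..q. max (real j) (?y * real (?J - j))) / real ?J ^ q) ^ L"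
    by (simp only: prod.distrib prod_power_distrib[symmetric] prod_dividef prod_constant
        card_atLeastAtMost diff_Suc_1)
  also have "\<dots> \<le> 4 ^ q * (fact q * (1 + ?y) ^ q / real ?J ^ q) ^ L"
    by (intro mult_left_mono power_mono divide_right_mono prod_max_le) (auto intro!: prod_nonneg divide_nonneg_nonneg simp: le_max_iff_disj)
  finally show ?thesis .
qed

text \<open>
  Multiplying the previous bound over all roots: the mean of the logarithm of
  \<open>(cmod (poly P w))\<^sup>2 / (1 + (cmod w)\<^sup>2) ^ N\<close> over the grid controls the product of the norms of the linear factors
  from below.  The gain of \<open>N\<close> is the origin of the factor \<open>exp N\<close> in the normalisation of the Bombieri constant, and
  the last summand tends to 0 as the grid is refined.
\<close>

lemma sum_ln_nodes_le:
  fixes z :: "nat \<Rightarrow> complex"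
  assumes L: "L > 0" and q: "q > 0" and a: "a \<noteq> 0"
    and P: "P = smult a (\<Prod>i=1..N. [:- z i, 1:])"
    and nz: "\<And>v. v \<in> {1..q} \<times> {..<L} \<Longrightarrow> poly P (node (Suc q) L v) \<noteq> 0"
  shows "(\<Sum>v\<in>{1..q}\<times>{..<L}. ln ((cmod (poly P (node (Suc q) L v)))\<^sup>2 / (1 + (cmod (node (Suc q) L v))\<^sup>2) ^ N))
           \<le> real q * real L * (ln ((cmod a)\<^sup>2 * (\<Prod>i=1..N. 1 + (cmod (z i))\<^sup>2)) - real N
                + real N * (ln 4 / real L + ln (real (Suc q)) / real q))"
proof -
  let ?J = "Suc q" and ?V = "{1..q} \<times> {..<L}"
  define F where "F v = (cmod (poly P (node ?J L v)))\<^sup>2 / (1 + (cmod (node ?J L v))\<^sup>2) ^ N" for v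
  define W where "W = (\<Prod>i=1..N. 1 + (cmod (z i))\<^sup>2)"
  have W: "W > 0" unfolding W_def by (intro prod_pos) (auto intro: add_pos_nonneg)
  have Fpos: "F v > 0" if "v \<in> ?V" for v
    using nz[OF that] unfolding F_def by (intro divide_pos_pos zero_less_power add_pos_nonneg) auto
  have F_eq: "F (j, b) = (cmod a)\<^sup>2 * (\<Prod>i=1..N. (cmod (node ?J L (j, b) - z i))\<^sup>2 * (real (?J - j) / real ?J))"
    if "j \<in> {1..q}" for j b
  proof -
    have n: "1 + (cmod (node ?J L (j, b)))\<^sup>2 = real ?J / real (?J - j)"
      using that by (simp add: node_def norm_mult power_mult_distrib of_nat_diff field_simps)
    have "(cmod (poly P (node ?J L (j, b))))\<^sup>2 = (cmod a)\<^sup>2 * (\<Prod>i=1..N. (cmod (node ?J L (j, b) - z i))\<^sup>2)"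
      by (simp add: P poly_prod norm_mult power_mult_distrib prod_norm[symmetric] prod_power_distrib)
    then show ?thesis unfolding F_def n prod.distrib prod_constant by (simp add: power_divide)
  qed
  have "(\<Prod>v\<in>?V. F v) = (\<Prod>j=1..q. \<Prod>b<L. F (j, b))"
    unfolding prod.cartesian_product' by simp
  also have "\<dots> = (\<Prod>j=1..q. \<Prod>b<L. (cmod a)\<^sup>2 * (\<Prod>i=1..N. (cmod (node ?J L (j, b) - z i))\<^sup>2 * (real (?J - j) / real ?J)))"
    by (intro prod.cong refl F_eq)
  also have "\<dots> = ((cmod a)\<^sup>2) ^ (q * L) *
      (\<Prod>j=1..q. \<Prod>b<L. \<Prod>i=1..N. (cmod (node ?J L (j, b) - z i))\<^sup>2 * (real (?J - j) / real ?J))"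
    by (simp only: prod.distrib prod_constant card_lessThan card_atLeastAtMost power_mult[symmetric])
       (simp add: mult_ac)
  also have "(\<Prod>j=1..q. \<Prod>b<L. \<Prod>i=1..N. (cmod (node ?J L (j, b) - z i))\<^sup>2 * (real (?J - j) / real ?J))
      = (\<Prod>i=1..N. \<Prod>j=1..q. \<Prod>b<L. (cmod (node ?J L (j, b) - z i))\<^sup>2 * (real (?J - j) / real ?J))"
  proof -
    have "(\<Prod>j=1..q. \<Prod>b<L. \<Prod>i=1..N. (cmod (node ?J L (j, b) - z i))\<^sup>2 * (real (?J - j) / real ?J))
        = (\<Prod>j=1..q. \<Prod>i=1..N. \<Prod>b<L. (cmod (node ?J L (j, b) - z i))\<^sup>2 * (real (?J - j) / real ?J))"
      by (intro prod.cong refl prod.swap)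
    also have "\<dots> = (\<Prod>i=1..N. \<Prod>j=1..q. \<Prod>b<L. (cmod (node ?J L (j, b) - z i))\<^sup>2 * (real (?J - j) / real ?J))"
      by (rule prod.swap)
    finally show ?thesis .
  qed
  also have "((cmod a)\<^sup>2) ^ (q * L) * \<dots>
      \<le> ((cmod a)\<^sup>2) ^ (q * L) * (\<Prod>i=1..N. 4 ^ q * (fact q * (1 + (cmod (z i))\<^sup>2) ^ q / real ?J ^ q) ^ L)"
    by (intro mult_left_mono prod_mono conjI prod_nodes_le L) (auto intro!: prod_nonneg)
  also have "\<dots> = ((cmod a)\<^sup>2 * W) ^ (q * L) * (4 ^ q * (fact q / real ?J ^ q) ^ L) ^ N"
  proof -
    have "4 ^ q * (fact q * (1 + (cmod (z i))\<^sup>2) ^ q / real ?J ^ q) ^ L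
        = (1 + (cmod (z i))\<^sup>2) ^ (q * L) * (4 ^ q * (fact q / real ?J ^ q) ^ L)" for i
      by (simp add: power_mult power_mult_distrib power_divide)
    then show ?thesis
      by (simp add: prod.distrib W_def power_mult_distrib prod_power_distrib)
  qed
  finally have le: "(\<Prod>v\<in>?V. F v) \<le> ((cmod a)\<^sup>2 * W) ^ (q * L) * (4 ^ q * (fact q / real ?J ^ q) ^ L) ^ N" .
  have "(\<Sum>v\<in>?V. ln (F v)) = ln (\<Prod>v\<in>?V. F v)"
    using Fpos by (intro ln_prod[symmetric]) (auto simp: less_le)
  also have "\<dots> \<le> ln (((cmod a)\<^sup>2 * W) ^ (q * L) * (4 ^ q * (fact q / real ?J ^ q) ^ L) ^ N)"
    using le Fpos by (intro ln_mono prod_pos) auto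
  also have "\<dots> = real q * real L * ln ((cmod a)\<^sup>2 * W)
      + real N * (real q * ln 4 + real L * (ln (fact q) - real q * ln (real ?J)))"
  proof -
    have "ln (((cmod a)\<^sup>2 * W) ^ (q * L) * (4 ^ q * (fact q / real ?J ^ q) ^ L) ^ N)
        = ln (((cmod a)\<^sup>2 * W) ^ (q * L)) + ln ((4 ^ q * (fact q / real ?J ^ q) ^ L) ^ N)"
      using a W by (intro ln_mult_pos) auto
    also have "ln ((4 ^ q * (fact q / real ?J ^ q) ^ L) ^ N) = real N * (ln (4 ^ q) + ln ((fact q / real ?J ^ q) ^ L))"
      unfolding ln_realpow[of _ N] by (subst ln_mult_pos) auto
    also have "ln ((fact q / real ?J ^ q) ^ L) = real L * (ln (fact q) - ln (real ?J ^ q))"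
      unfolding ln_realpow[of _ L] by (subst ln_divide_pos) auto
    finally show ?thesis by (simp only: ln_realpow of_nat_mult)
  qed
  also have "\<dots> \<le> real q * real L * ln ((cmod a)\<^sup>2 * W)
      + real N * (real q * ln 4 + real L * (ln (real ?J) - real q))"
  proof -
    have "fact q \<le> real ?J ^ ?J * exp (1 - real ?J)" using fact_le_power_exp[of ?J] by simp
    then have "ln (fact q) \<le> ln (real ?J ^ ?J * exp (1 - real ?J))" by (intro ln_mono) auto
    also have "\<dots> = real ?J * ln (real ?J) + (1 - real ?J)"
      by (subst ln_mult_pos) (auto simp only: ln_realpow ln_exp zero_less_power of_nat_0_less_iff zero_less_Suc exp_gt_zero)
    finally have "ln (fact q) - real q * ln (real ?J) \<le> ln (real ?J) - real q" by (simp add: algebra_simps)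
    then show ?thesis by (intro add_left_mono mult_left_mono) auto
  qed
  also have "\<dots> = real q * real L * (ln ((cmod a)\<^sup>2 * W) - real N
                + real N * (ln 4 / real L + ln (real ?J) / real q))"
    using L q by (simp add: field_simps)
  finally show ?thesis unfolding F_def W_def .
qed

section \<open>Random polynomials\<close>

text \<open>
  With Gaussian \<open>g\<close> this is a random polynomial whose Bombieri-Weyl norm is the Euclidean length of
  \<open>g\<close>.
\<close>

definition su2_poly :: "nat \<Rightarrow> (nat \<Rightarrow> real) \<Rightarrow> complex poly" where
  "su2_poly N g = (\<Sum>k\<le>N. monom (of_real (g k * sqrt (real (N choose k)))) k)"

lemma coeff_su2_poly: "coeff (su2_poly N g) k = (if k \<le> N then of_real (g k * sqrt (real (N choose k))) else 0)"
  by (simp add: su2_poly_def coeff_sum)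

lemma degree_su2_poly: "g N \<noteq> 0 \<Longrightarrow> degree (su2_poly N g) = N"
  by (intro antisym degree_le le_degree) (auto simp: coeff_su2_poly)

lemma bw_norm_su2_poly: "g N \<noteq> 0 \<Longrightarrow> (bw_norm (su2_poly N g))\<^sup>2 = (\<Sum>k\<le>N. (g k)\<^sup>2)"
  unfolding bw_norm_squared
  by (intro sum.cong) (auto simp: degree_su2_poly coeff_su2_poly norm_mult power_mult_distrib)

text \<open>
  The normalised value at a point is a complex linear form in \<open>g\<close> with coefficient vector of length 1, so
  its real or its imaginary part has a coefficient vector of squared length at least \<open>1 / 2\<close>.
\<close>

lemma exists_real_direction:
  "\<exists>u. (\<Sum>k\<le>N. (u k)\<^sup>2) \<ge> 1 / 2 \<and>
       (\<forall>g. (\<Sum>k\<le>N. g k * u k)\<^sup>2 \<le> (cmod (poly (su2_poly N g) \<zeta>))\<^sup>2 / (1 + (cmod \<zeta>)\<^sup>2) ^ N)"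
proof -
  define s where "s = sqrt ((1 + (cmod \<zeta>)\<^sup>2) ^ N)"
  have pos: "(1 + (cmod \<zeta>)\<^sup>2) ^ N > 0" by (intro zero_less_power add_pos_nonneg) auto
  then have s: "s > 0" "s\<^sup>2 = (1 + (cmod \<zeta>)\<^sup>2) ^ N" by (auto simp: s_def)
  define w where "w k = of_real (sqrt (real (N choose k)) / s) * \<zeta> ^ k" for k
  have eval: "poly (su2_poly N g) \<zeta> = of_real s * (\<Sum>k\<le>N. of_real (g k) * w k)" for g
    using s(1) by (simp add: su2_poly_def poly_sum poly_monom w_def sum_distrib_left mult_ac)
  have F: "(cmod (poly (su2_poly N g) \<zeta>))\<^sup>2 / (1 + (cmod \<zeta>)\<^sup>2) ^ N = (cmod (\<Sum>k\<le>N. of_real (g k) * w k))\<^sup>2" for g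
    unfolding eval s(2)[symmetric] using s(1) by (simp add: norm_mult power_mult_distrib)
  have "(\<Sum>k\<le>N. (cmod (w k))\<^sup>2) = (\<Sum>k\<le>N. real (N choose k) * ((cmod \<zeta>)\<^sup>2) ^ k) / s\<^sup>2"
    unfolding sum_divide_distrib
  proof (intro sum.cong refl)
    fix k
    have "cmod (w k) = sqrt (real (N choose k)) / s * cmod \<zeta> ^ k"
      using s(1) by (simp add: w_def norm_mult norm_power norm_divide)
    moreover have "(cmod \<zeta> ^ k)\<^sup>2 = ((cmod \<zeta>)\<^sup>2) ^ k"
      by (simp only: power_mult[symmetric] mult.commute)
    ultimately show "(cmod (w k))\<^sup>2 = real (N choose k) * ((cmod \<zeta>)\<^sup>2) ^ k / s\<^sup>2"
      by (simp add: power_mult_distrib power_divide)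
  qed
  also have "\<dots> = 1"
    using pos binomial_ring[of "(cmod \<zeta>)\<^sup>2" 1 N] unfolding s(2) by (simp add: add.commute)
  finally have one: "(\<Sum>k\<le>N. (Re (w k))\<^sup>2) + (\<Sum>k\<le>N. (Im (w k))\<^sup>2) = 1"
    by (simp add: cmod_power2 sum.distrib)
  have re: "(\<Sum>k\<le>N. g k * Re (w k))\<^sup>2 \<le> (cmod (\<Sum>k\<le>N. of_real (g k) * w k))\<^sup>2" for g
    unfolding cmod_power2 by simp
  have im: "(\<Sum>k\<le>N. g k * Im (w k))\<^sup>2 \<le> (cmod (\<Sum>k\<le>N. of_real (g k) * w k))\<^sup>2" for g
    unfolding cmod_power2 by simp
  show ?thesis
  proof (cases "(\<Sum>k\<le>N. (Re (w k))\<^sup>2) \<ge> 1 / 2")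
    case True
    then show ?thesis using re unfolding F by (intro exI[of _ "\<lambda>k. Re (w k)"]) auto
  next
    case False
    then have "(\<Sum>k\<le>N. (Im (w k))\<^sup>2) \<ge> 1 / 2" using one by linarith
    then show ?thesis using im unfolding F by (intro exI[of _ "\<lambda>k. Im (w k)"]) auto
  qed
qed

lemma ennreal_sum_divide:
  assumes "\<And>v. v \<in> A \<Longrightarrow> h v \<ge> 0" "r > 0"
  shows "ennreal (sum h A / r) = (\<Sum>v\<in>A. ennreal (1 / r) * ennreal (h v))"
  using assms by (simp add: ennreal_mult'[symmetric] sum_ennreal sum_divide_distrib)

lemma nn_integral_sum_cmult:
  fixes c :: ennreal
  assumes "\<And>v. v \<in> A \<Longrightarrow> f v \<in> borel_measurable M"
  shows "(\<integral>\<^sup>+ x. (\<Sum>v\<in>A. c * f v x) \<partial>M) = (\<Sum>v\<in>A. c * (\<integral>\<^sup>+ x. f v x \<partial>M))"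
  using assms by (subst nn_integral_sum) (auto simp: nn_integral_cmult)

text \<open>
  The mean over Gaussian \<open>g\<close> of \<open>S / card V\<close>, the grid average of the negative parts of the logarithms, is at most
  \<open>4 / sqrt pi\<close>, and the mean of the squared norm \<open>T\<close>, divided by \<open>N + 1\<close>, is 1.  Hence some polynomial is almost
  as good as the mean for the sum of both.  For it the logarithmic mean is not too negative while the norm is not too
  large, because \<open>ln t \<le> t - 1\<close>; the roots of this polynomial are the required points.
\<close>

theorem exists_near_extremal_roots:
  assumes \<eta>: "\<eta> > 0"
  shows "\<exists>z. exp (real N - 4 / sqrt pi - \<eta>) / (real N + 1) * (bw_norm (\<Prod>i=1..N. [:- z i, 1:]))\<^sup>2
           \<le> (\<Prod>i=1..N. 1 + (cmod (z i))\<^sup>2)"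
proof -
  have "(\<lambda>q. real N * (ln 4 / real q + ln (real (Suc q)) / real q)) \<longlonglongrightarrow> 0"
  proof -
    have "(\<lambda>q. ln 4 / real q + ln (real (Suc q)) / real q) \<longlonglongrightarrow> 0" by real_asymp
    from tendsto_mult_left[OF this, of "real N"] show ?thesis by simp
  qed
  then have "eventually (\<lambda>q. real N * (ln 4 / real q + ln (real (Suc q)) / real q) < \<eta> / 2) sequentially"
    using \<eta> by (intro order_tendstoD) auto
  then have "eventually (\<lambda>q. q > 0 \<and> real N * (ln 4 / real q + ln (real (Suc q)) / real q) < \<eta> / 2) sequentially"
    using eventually_gt_at_top[of 0] by eventually_elim auto
  then obtain q where q: "q > 0" and small: "real N * (ln 4 / real q + ln (real (Suc q)) / real q) < \<eta> / 2"
    by (auto simp: eventually_sequentially)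
  define V where "V = {1..q} \<times> {..<q}"
  have finV: "finite V" and cardV: "real (card V) = real q * real q" by (auto simp: V_def)
  define F where "F g v = (cmod (poly (su2_poly N g) (node (Suc q) q v)))\<^sup>2 / (1 + (cmod (node (Suc q) q v))\<^sup>2) ^ N" for g v
  have "\<exists>u. \<forall>v. (\<Sum>k\<le>N. (u v k)\<^sup>2) \<ge> 1 / 2 \<and> (\<forall>g. (\<Sum>k\<le>N. g k * u v k)\<^sup>2 \<le> F g v)"
    unfolding F_def by (intro choice allI exists_real_direction)
  then obtain u where u: "\<And>v. (\<Sum>k\<le>N. (u v k)\<^sup>2) \<ge> 1 / 2" "\<And>v g. (\<Sum>k\<le>N. g k * u v k)\<^sup>2 \<le> F g v"
    by blast
  define Y where "Y g v = (\<Sum>k\<le>N. g k * u v k)" for g v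
  interpret G: prob_space "gauss N" by (rule prob_space_gauss)
  have upos: "(\<Sum>k\<le>N. (u v k)\<^sup>2) > 0" for v using u(1)[of v] by linarith
  have measY: "(\<lambda>g. Y g v) \<in> borel_measurable (gauss N)" for v
    unfolding Y_def by (intro borel_measurable_sum borel_measurable_times measurable_gauss_coord) auto
  define S where "S g = (\<Sum>v\<in>V. max 0 (- ln ((Y g v)\<^sup>2)))" for g
  define T where "T g = (\<Sum>k\<le>N. (g k)\<^sup>2)" for g :: "nat \<Rightarrow> real"
  define c where "c = 4 / sqrt pi"
  have c: "c \<ge> 0" by (simp add: c_def)
  have ae: "AE g in gauss N. (\<forall>v\<in>V. Y g v \<noteq> 0) \<and> g N \<noteq> 0"
  proof -
    have "AE g in gauss N. Y g v \<noteq> 0" for v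
      unfolding Y_def by (rule AE_gauss_linear_nonzero[OF upos])
    then have "AE g in gauss N. \<forall>v\<in>V. Y g v \<noteq> 0"
      by (intro AE_finite_allI finV)
    moreover have "AE g in gauss N. g N \<noteq> 0"
    proof -
      have "(\<Sum>k\<le>N. (if k = N then 1 else 0 :: real)\<^sup>2) > 0" by (rule sum_pos2[of _ N]) auto
      from AE_gauss_linear_nonzero[OF this] show ?thesis
        by (simp add: if_distrib[of "\<lambda>x. _ * x"] cong: if_cong)
    qed
    ultimately show ?thesis by eventually_elim auto
  qed
  have int: "(\<integral>\<^sup>+ g. ennreal (S g / real (card V) + T g / (real N + 1)) \<partial>gauss N) \<le> ennreal (c + 1)"
  proof -
    have cV: "real (card V) > 0" using q by (simp add: cardV)
    have "(\<integral>\<^sup>+ g. ennreal (S g / real (card V) + T g / (real N + 1)) \<partial>gauss N)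
        = (\<integral>\<^sup>+ g. (\<Sum>v\<in>V. ennreal (1 / real (card V)) * ennreal (max 0 (- ln ((Y g v)\<^sup>2))))
            + (\<Sum>k\<le>N. ennreal (1 / (real N + 1)) * ennreal ((g k)\<^sup>2)) \<partial>gauss N)"
    proof (intro nn_integral_cong)
      fix g
      have "ennreal (S g / real (card V)) = (\<Sum>v\<in>V. ennreal (1 / real (card V)) * ennreal (max 0 (- ln ((Y g v)\<^sup>2))))"
        unfolding S_def using cV by (intro ennreal_sum_divide) auto
      moreover have "ennreal (T g / (real N + 1)) = (\<Sum>k\<le>N. ennreal (1 / (real N + 1)) * ennreal ((g k)\<^sup>2))"
        unfolding T_def by (intro ennreal_sum_divide) auto
      moreover have "S g \<ge> 0" "T g \<ge> 0" unfolding S_def T_def by (auto intro!: sum_nonneg)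
      ultimately show "ennreal (S g / real (card V) + T g / (real N + 1))
          = (\<Sum>v\<in>V. ennreal (1 / real (card V)) * ennreal (max 0 (- ln ((Y g v)\<^sup>2))))
            + (\<Sum>k\<le>N. ennreal (1 / (real N + 1)) * ennreal ((g k)\<^sup>2))"
        by (subst ennreal_plus) auto
    qed
    also have "\<dots> = (\<Sum>v\<in>V. ennreal (1 / real (card V)) * (\<integral>\<^sup>+ g. ennreal (max 0 (- ln ((Y g v)\<^sup>2))) \<partial>gauss N))
            + (\<Sum>k\<le>N. ennreal (1 / (real N + 1)) * (\<integral>\<^sup>+ g. ennreal ((g k)\<^sup>2) \<partial>gauss N))"
    proof -
      have m1: "(\<lambda>g. ennreal (max 0 (- ln ((Y g v)\<^sup>2)))) \<in> borel_measurable (gauss N)" for v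
        using measY[of v] by measurable
      have m2: "(\<lambda>g. ennreal ((g k)\<^sup>2)) \<in> borel_measurable (gauss N)" if "k \<le> N" for k
        using measurable_gauss_coord[OF that] by measurable
      have e1: "(\<integral>\<^sup>+ g. (\<Sum>v\<in>V. ennreal (1 / real (card V)) * ennreal (max 0 (- ln ((Y g v)\<^sup>2)))) \<partial>gauss N)
          = (\<Sum>v\<in>V. ennreal (1 / real (card V)) * (\<integral>\<^sup>+ g. ennreal (max 0 (- ln ((Y g v)\<^sup>2))) \<partial>gauss N))"
        by (rule nn_integral_sum_cmult) (rule m1)
      have e2: "(\<integral>\<^sup>+ g. (\<Sum>k\<le>N. ennreal (1 / (real N + 1)) * ennreal ((g k)\<^sup>2)) \<partial>gauss N)
          = (\<Sum>k\<le>N. ennreal (1 / (real N + 1)) * (\<integral>\<^sup>+ g. ennreal ((g k)\<^sup>2) \<partial>gauss N))"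
        by (rule nn_integral_sum_cmult) (use m2 in auto)
      show ?thesis
        using m1 m2
        by (subst nn_integral_add; (intro borel_measurable_sum borel_measurable_times borel_measurable_const; simp)?)
           (simp only: e1 e2)
    qed
    also have "\<dots> \<le> (\<Sum>v\<in>V. ennreal (1 / real (card V)) * ennreal c) + (\<Sum>k\<le>N. ennreal (1 / (real N + 1)) * 1)"
    proof (intro add_mono sum_mono mult_left_mono)
      show "(\<integral>\<^sup>+ g. ennreal (max 0 (- ln ((Y g v)\<^sup>2))) \<partial>gauss N) \<le> ennreal c" for v
        unfolding Y_def c_def by (rule nn_integral_gauss_neg_ln_le[OF u(1)])
    qed (auto simp: nn_integral_gauss_square)
    also have "\<dots> = ennreal (c + 1)"
    proof -
      have "(\<Sum>v\<in>V. ennreal (1 / real (card V)) * ennreal c) = ennreal ((\<Sum>v\<in>V. c) / real (card V))"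
        using c cV by (intro ennreal_sum_divide[symmetric]) auto
      moreover have "(\<Sum>k\<le>N. ennreal (1 / (real N + 1)) * 1) = ennreal ((\<Sum>k\<le>N. 1) / (real N + 1))"
        using ennreal_sum_divide[of "{..N}" "\<lambda>_. 1" "real N + 1"] by simp
      moreover have "(\<Sum>v\<in>V. c) / real (card V) = c" "(\<Sum>k\<le>N. 1) / (real N + 1) = 1"
        using cV by auto
      ultimately show ?thesis using c by (simp only: ennreal_plus[symmetric])
    qed
    finally show ?thesis .
  qed
  have "\<eta> / 2 > 0" "0 \<le> c + 1" using \<eta> c by auto
  then obtain g where g': "(\<forall>v\<in>V. Y g v \<noteq> 0) \<and> g N \<noteq> 0"
    and ST: "S g / real (card V) + T g / (real N + 1) \<le> c + 1 + \<eta> / 2"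
    by (rule G.exists_le_nn_integral[OF ae int])
  have g: "\<And>v. v \<in> V \<Longrightarrow> Y g v \<noteq> 0" "g N \<noteq> 0" using g' by auto
  define P where "P = su2_poly N g"
  have degP: "degree P = N" unfolding P_def by (rule degree_su2_poly[of g N, OF g(2)])
  have P0: "P \<noteq> 0" using g(2) coeff_su2_poly[of N g N] by (auto simp: P_def)
  define a where "a = lead_coeff P"
  have a: "a \<noteq> 0" using P0 by (simp add: a_def)
  obtain z where z: "P = smult a (\<Prod>i=1..N. [:- z i, 1:])"
    using complex_poly_splits[OF P0] degP unfolding a_def by metis
  define M where "M = (\<Prod>i=1..N. [:- z i, 1:])"
  define W where "W = (\<Prod>i=1..N. 1 + (cmod (z i))\<^sup>2)"
  have W: "W > 0" unfolding W_def by (intro prod_pos) (auto intro: add_pos_nonneg)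
  have Tnorm: "T g = (cmod a)\<^sup>2 * (bw_norm M)\<^sup>2"
  proof -
    have "T g = (bw_norm P)\<^sup>2" unfolding T_def P_def by (rule bw_norm_su2_poly[of g N, OF g(2), symmetric])
    then show ?thesis unfolding z M_def[symmetric] bw_norm_smult power_mult_distrib .
  qed
  have Fpos: "F g v > 0" if "v \<in> V" for v
    using u(2)[of g v] g(1)[OF that] by (auto simp: Y_def intro: less_le_trans[rotated])
  have "- S g \<le> (\<Sum>v\<in>V. ln (F g v))"
    unfolding S_def sum_negf[symmetric]
  proof (intro sum_mono)
    fix v assume v: "v \<in> V"
    have "ln ((Y g v)\<^sup>2) \<le> ln (F g v)"
      using u(2)[of g v] g(1)[OF v] by (intro ln_mono) (auto simp: Y_def)
    then show "- max 0 (- ln ((Y g v)\<^sup>2)) \<le> ln (F g v)" by linarith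
  qed
  also have "\<dots> \<le> real q * real q * (ln ((cmod a)\<^sup>2 * W) - real N
      + real N * (ln 4 / real q + ln (real (Suc q)) / real q))"
    unfolding F_def P_def[symmetric] W_def V_def
  proof (rule sum_ln_nodes_le[OF q q a z])
    fix v assume "v \<in> {1..q} \<times> {..<q}"
    then have "F g v > 0" using Fpos by (simp add: V_def)
    then show "poly P (node (Suc q) q v) \<noteq> 0" by (auto simp: F_def P_def)
  qed
  also have "\<dots> \<le> real q * real q * (ln ((cmod a)\<^sup>2 * W) - real N + \<eta> / 2)"
    using small by (intro mult_left_mono) auto
  finally have "- (S g / real (card V)) \<le> ln ((cmod a)\<^sup>2 * W) - real N + \<eta> / 2"
    using q by (simp add: cardV field_simps)
  moreover have Tpos: "T g / (real N + 1) > 0"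
  proof -
    have "T g > 0" unfolding T_def by (rule sum_pos2[of _ N]) (use g(2) in auto)
    then show ?thesis by simp
  qed
  moreover have "ln (T g / (real N + 1)) \<le> T g / (real N + 1) - 1"
    using Tpos by (rule ln_le_minus_one)
  ultimately have "real N - c - \<eta> + ln (T g / (real N + 1)) \<le> ln ((cmod a)\<^sup>2 * W)"
    using ST by linarith
  then have "exp (real N - c - \<eta> + ln (T g / (real N + 1))) \<le> exp (ln ((cmod a)\<^sup>2 * W))" by simp
  then have "exp (real N - c - \<eta>) * (T g / (real N + 1)) \<le> (cmod a)\<^sup>2 * W"
    using Tpos a W by (simp add: exp_add)
  then have "(cmod a)\<^sup>2 * (exp (real N - c - \<eta>) / (real N + 1) * (bw_norm M)\<^sup>2) \<le> (cmod a)\<^sup>2 * W"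
    by (simp add: Tnorm mult_ac)
  then have "exp (real N - c - \<eta>) / (real N + 1) * (bw_norm M)\<^sup>2 \<le> W"
    using a by (subst (asm) mult_le_cancel_left_pos) auto
  then show ?thesis unfolding M_def W_def c_def by blast
qed

text \<open>
  The Bombieri constant is an infimum of real numbers, so a lower bound for it presupposes that some constant is
  admissible.  The \<open>N\<close> roots cannot come close to all of the \<open>N + 1\<close> points \<open>0, \<dots>, N\<close>; at a point
  which they avoid, the polynomial is comparable to the product of the norms of its factors, and its
  value there is bounded by its coefficients.
\<close>

lemma admissible_const_exists:
  "\<exists>C. \<forall>z :: nat \<Rightarrow> complex.
     (\<Prod>i=1..N. bw_norm [:- z i, 1:]) \<le> C * bw_norm (\<Prod>i=1..N. [:- z i, 1:])"
proof -
  define B where "B = 2 * real N + 3"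
  have B: "B > 0" by (simp add: B_def)
  have far: "sqrt (1 + (cmod w)\<^sup>2) \<le> B * cmod (of_nat m - w)" if "m \<le> N" "cmod (of_nat m - w) \<ge> 1 / 2" for m w
  proof -
    have "sqrt (1 + (cmod w)\<^sup>2) \<le> 1 + cmod w"
      by (rule real_le_lsqrt) (auto simp: power2_eq_square algebra_simps)
    also have "cmod w \<le> cmod (of_nat m) + cmod (of_nat m - w)"
      using norm_triangle_ineq4[of "of_nat m" "of_nat m - w"] by simp
    also have "cmod (of_nat m) \<le> real N" using that(1) by simp
    also have "1 + (real N + cmod (of_nat m - w)) \<le> B * cmod (of_nat m - w)"
    proof -
      have "(2 * real N + 2) * (1 / 2) \<le> (2 * real N + 2) * cmod (of_nat m - w)"
        using that(2) by (intro mult_left_mono) auto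
      then show ?thesis by (simp add: B_def algebra_simps)
    qed
    finally show ?thesis by simp
  qed
  define D where "D = real (N + 1) * (2 * (real N + 1)) ^ N"
  show ?thesis
  proof (intro exI allI)
    fix z :: "nat \<Rightarrow> complex"
    define M where "M = (\<Prod>i=1..N. [:- z i, 1:])"
    have degM: "degree M = N"
      by (simp add: M_def degree_prod_sum_eq)
    have "\<exists>m\<le>N. \<forall>i\<in>{1..N}. cmod (of_nat m - z i) \<ge> 1 / 2"
    proof (rule ccontr)
      assume "\<not> ?thesis"
      then have "\<forall>m\<in>{..N}. \<exists>i\<in>{1..N}. cmod (of_nat m - z i) < 1 / 2" by force
      then obtain f where f: "\<forall>m\<in>{..N}. f m \<in> {1..N} \<and> cmod (of_nat m - z (f m)) < 1 / 2" by metis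
      have "inj_on f {..N}"
      proof (rule inj_onI)
        fix m m' assume mm: "m \<in> {..N}" "m' \<in> {..N}" "f m = f m'"
        have "cmod (of_nat m - of_nat m') \<le> cmod (of_nat m - z (f m)) + cmod (of_nat m' - z (f m))"
          using norm_triangle_ineq4[of "of_nat m - z (f m)" "of_nat m' - z (f m)"] by simp
        also have "cmod (of_nat m - z (f m)) < 1 / 2" using f mm(1) by blast
        also have "cmod (of_nat m' - z (f m)) < 1 / 2" unfolding mm(3) using f mm(2) by blast
        finally have "cmod (of_nat m - of_nat m') < 1" by simp
        then have "\<bar>real m - real m'\<bar> < 1"
          by (metis norm_of_real of_real_diff of_real_of_nat_eq)
        then show "m = m'" by linarith
      qed
      then have "card {..N} \<le> card {1..N}" using f by (intro card_inj_on_le) auto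
      then show False by simp
    qed
    then obtain m where m: "m \<le> N" "\<And>i. i \<in> {1..N} \<Longrightarrow> cmod (of_nat m - z i) \<ge> 1 / 2" by blast
    have "(\<Prod>i=1..N. bw_norm [:- z i, 1:]) \<le> (\<Prod>i=1..N. B * cmod (of_nat m - z i))"
      unfolding bw_norm_linear by (intro prod_mono conjI far m) auto
    also have "\<dots> = B ^ N * cmod (poly M (of_nat m))"
      by (simp add: M_def poly_prod prod.distrib prod_norm)
    also have "cmod (poly M (of_nat m)) \<le> D * bw_norm M"
    proof -
      have coeff_le: "cmod (coeff M k) \<le> 2 ^ N * bw_norm M" if "k \<le> N" for k
      proof -
        have "real (N choose k) > 0" using that by simp
        have "real (N choose k) \<le> 2 ^ N"
          by (metis binomial_le_pow2 of_nat_le_iff of_nat_numeral of_nat_power)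
        also have "\<dots> \<le> 2 ^ N * 2 ^ N" by simp
        finally have ch: "real (N choose k) \<le> (2 ^ N)\<^sup>2" by (simp add: power2_eq_square)
        have "(cmod (coeff M k))\<^sup>2 / real (N choose k) \<le> (bw_norm M)\<^sup>2"
          unfolding bw_norm_squared degM using that
          by (intro member_le_sum[of k "{..N}" "\<lambda>i. (cmod (coeff M i))\<^sup>2 / real (N choose i)"]) auto
        then have "(cmod (coeff M k))\<^sup>2 \<le> real (N choose k) * (bw_norm M)\<^sup>2"
          using \<open>real (N choose k) > 0\<close> by (simp add: field_simps)
        also have "\<dots> \<le> (2 ^ N)\<^sup>2 * (bw_norm M)\<^sup>2" using ch by (intro mult_right_mono) auto
        finally have "(cmod (coeff M k))\<^sup>2 \<le> (2 ^ N * bw_norm M)\<^sup>2" by (simp add: power_mult_distrib)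
        then show ?thesis by (rule power2_le_imp_le) (simp add: bw_norm_nonneg)
      qed
      have "poly M (of_nat m) = (\<Sum>k\<le>N. coeff M k * of_nat m ^ k)" by (simp add: poly_altdef degM)
      also have "cmod \<dots> \<le> (\<Sum>k\<le>N. 2 ^ N * bw_norm M * (real N + 1) ^ N)"
      proof (rule sum_norm_le)
        fix k assume "k \<in> {..N}"
        have "real m ^ k \<le> (real N + 1) ^ k" using m(1) by (intro power_mono) auto
        also have "\<dots> \<le> (real N + 1) ^ N" using \<open>k \<in> {..N}\<close> by (intro power_increasing) auto
        finally show "cmod (coeff M k * of_nat m ^ k) \<le> 2 ^ N * bw_norm M * (real N + 1) ^ N"
          unfolding norm_mult norm_power norm_of_nat
          using coeff_le \<open>k \<in> {..N}\<close> by (intro mult_mono) (auto simp: bw_norm_nonneg)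
      qed
      also have "\<dots> = real (N + 1) * (2 ^ N * bw_norm M * (real N + 1) ^ N)" by simp
      also have "\<dots> = D * bw_norm M" unfolding D_def power_mult_distrib by (simp only: mult_ac)
      finally show ?thesis .
    qed
    finally show "(\<Prod>i=1..N. bw_norm [:- z i, 1:]) \<le> (B ^ N * D) * bw_norm (\<Prod>i=1..N. [:- z i, 1:])"
      using B by (simp add: M_def mult.assoc)
  qed
qed

text \<open>
  The normalisation \<open>sqrt (exp N / (N + 1))\<close> cancels all growth in \<open>N\<close>, so the bound is the same for every \<open>N\<close>.
\<close>

theorem bombieri_K_ge: "bombieri_K N \<ge> exp (- 2 / sqrt pi)"
proof -
  have "bombieri_K N \<ge> exp (- 2 / sqrt pi - \<eta> / 2)" if \<eta>: "\<eta> > 0" for \<eta>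
  proof -
    obtain z where z: "exp (real N - 4 / sqrt pi - \<eta>) / (real N + 1) * (bw_norm (\<Prod>i=1..N. [:- z i, 1:]))\<^sup>2
           \<le> (\<Prod>i=1..N. 1 + (cmod (z i))\<^sup>2)"
      using exists_near_extremal_roots[OF \<eta>] by blast
    define M where "M = (\<Prod>i=1..N. [:- z i, 1:])"
    have "M \<noteq> 0" unfolding M_def by (simp add: prod_zero_iff)
    then have Mpos: "bw_norm M > 0" by (rule bw_norm_pos)
    have "sqrt (exp (real N - 4 / sqrt pi - \<eta>) / (real N + 1)) * bw_norm M
        = sqrt (exp (real N - 4 / sqrt pi - \<eta>) / (real N + 1) * (bw_norm M)\<^sup>2)"
      using Mpos by (simp only: real_sqrt_mult real_sqrt_abs abs_of_pos)
    also have "\<dots> \<le> sqrt (\<Prod>i=1..N. 1 + (cmod (z i))\<^sup>2)"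
      using z unfolding M_def by (rule real_sqrt_le_mono)
    also have "\<dots> = (\<Prod>i=1..N. bw_norm [:- z i, 1:])"
      unfolding bw_norm_linear by (induction N) (simp_all add: prod.nat_ivl_Suc' real_sqrt_mult)
    finally have le: "sqrt (exp (real N - 4 / sqrt pi - \<eta>) / (real N + 1)) * bw_norm M
        \<le> (\<Prod>i=1..N. bw_norm [:- z i, 1:])" .
    have "sqrt (exp (real N - 4 / sqrt pi - \<eta>) / (real N + 1)) \<le> bombieri_const N"
      unfolding bombieri_const_def
    proof (rule cInf_greatest)
      show "{C. \<forall>z :: nat \<Rightarrow> complex. (\<Prod>i=1..N. bw_norm [:- z i, 1:]) \<le> C * bw_norm (\<Prod>i=1..N. [:- z i, 1:])} \<noteq> {}"
        using admissible_const_exists[of N] by blast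
    next
      fix C assume "C \<in> {C. \<forall>z :: nat \<Rightarrow> complex. (\<Prod>i=1..N. bw_norm [:- z i, 1:]) \<le> C * bw_norm (\<Prod>i=1..N. [:- z i, 1:])}"
      then have "(\<Prod>i=1..N. bw_norm [:- z i, 1:]) \<le> C * bw_norm M" unfolding M_def by blast
      with le have "sqrt (exp (real N - 4 / sqrt pi - \<eta>) / (real N + 1)) * bw_norm M \<le> C * bw_norm M" by linarith
      then show "sqrt (exp (real N - 4 / sqrt pi - \<eta>) / (real N + 1)) \<le> C" using Mpos by simp
    qed
    moreover have "exp (real N - 4 / sqrt pi - \<eta>) / (real N + 1) = (exp (- 2 / sqrt pi - \<eta> / 2))\<^sup>2 * (exp (real N) / (real N + 1))"
      by (simp add: power2_eq_square flip: exp_add)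
    ultimately have "sqrt ((exp (- 2 / sqrt pi - \<eta> / 2))\<^sup>2 * (exp (real N) / (real N + 1))) \<le> bombieri_const N"
      by (simp only:)
    then have "exp (- 2 / sqrt pi - \<eta> / 2) * sqrt (exp (real N) / (real N + 1)) \<le> bombieri_const N"
      by (simp only: real_sqrt_mult real_sqrt_abs abs_exp_cancel)
    moreover have "sqrt (exp (real N) / (real N + 1)) > 0" by (simp add: add_pos_nonneg)
    ultimately show ?thesis unfolding bombieri_K_def by (simp add: pos_le_divide_eq)
  qed
  moreover have "((\<lambda>\<eta>. exp (- 2 / sqrt pi - \<eta> / 2)) \<longlongrightarrow> exp (- 2 / sqrt pi - 0 / 2)) (at_right 0)"
    by (intro tendsto_intros) simp
  ultimately show ?thesis
    by (intro tendsto_upperbound[of "\<lambda>\<eta>. exp (- 2 / sqrt pi - \<eta> / 2)" _ "at_right 0"])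
       (auto simp: eventually_at_right_less eventually_at_filter)
qed

section \<open>Bounds for the constant of the energy expansion\<close>

text \<open>
  The difference of \<open>ln (fact n)\<close> and its Stirling approximation decreases by at most \<open>1 / (4 * n * (n + 1))\<close>
  from \<open>n\<close> to \<open>n + 1\<close>, by the trapezoidal bound \<open>ln x \<le> (x - 1 / x) / 2\<close>.  These steps telescope, which
  explains the summand \<open>1 / (4 * n)\<close>; it is what makes the induction go through.
\<close>

lemma ln_fact_ge_stirling:
  assumes "n \<ge> 1"
  shows "ln (fact n) \<ge> real n * ln (real n) - real n + ln (real n) / 2 + 3 / 4 + 1 / (4 * real n)"
  using assms
proof (induction n rule: dec_induct)
  case (step n)
  have n: "real n > 0" using step by simp
  have ln_le: "ln x \<le> (x - 1 / x) / 2" if "x \<ge> 1" for x :: real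
  proof -
    define f where "f t = (t - 1 / t) / 2 - ln t" for t :: real
    have "f 1 \<le> f x"
    proof (rule DERIV_nonneg_imp_nondecreasing[OF that])
      fix t :: real assume t: "1 \<le> t" "t \<le> x"
      have "(f has_real_derivative ((1 + 1 / t\<^sup>2) / 2 - 1 / t)) (at t)"
        unfolding f_def using t by (auto intro!: derivative_eq_intros simp: power2_eq_square)
      moreover have "(1 + 1 / t\<^sup>2) / 2 - 1 / t = (1 - 1 / t)\<^sup>2 / 2"
        by (simp add: power2_eq_square algebra_simps)
      ultimately show "\<exists>y. (f has_real_derivative y) (at t) \<and> 0 \<le> y" by auto
    qed
    then show ?thesis by (simp add: f_def)
  qed
  define l where "l = ln (1 + 1 / real n)"
  have l: "l \<le> (1 / real n + 1 / (real n + 1)) / 2"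
  proof -
    have "(1 + 1 / real n) - 1 / (1 + 1 / real n) = 1 / real n + 1 / (real n + 1)"
      using n by (simp add: divide_simps) (simp add: algebra_simps)
    then show ?thesis using ln_le[of "1 + 1 / real n"] n by (simp add: l_def)
  qed
  have lnS: "ln (real (Suc n)) = ln (real n) + l"
  proof -
    have "real (Suc n) = real n * (1 + 1 / real n)" using n by (simp add: field_simps)
    then show ?thesis using n unfolding l_def by (metis ln_mult_pos add_pos_pos divide_pos_pos zero_less_one)
  qed
  have "(real n + 1 / 2) * l \<le> (real n + 1 / 2) * ((1 / real n + 1 / (real n + 1)) / 2)"
    using l n by (intro mult_left_mono) auto
  also have "\<dots> = 1 + 1 / (4 * real n) - 1 / (4 * (real n + 1))"
    using n by (simp add: divide_simps) (simp add: algebra_simps)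
  finally have key: "(real n + 1 / 2) * l \<le> 1 + 1 / (4 * real n) - 1 / (4 * (real n + 1))" .
  have "ln (fact (Suc n)) = ln (real (Suc n)) + ln (fact n)"
    unfolding fact_Suc by (subst ln_mult_pos) auto
  then show ?case using step.IH key unfolding lnS by (simp add: algebra_simps add_divide_distrib del: fact_Suc)
qed simp

text \<open>
  Induction on \<open>n\<close>: passing from row \<open>n\<close> to row \<open>n + 1\<close> of Pascal's triangle multiplies the entry \<open>k\<close> by
  \<open>(n + 1) / (n + 1 - k)\<close>.
\<close>

lemma sum_ln_binomial:
  "(\<Sum>k\<le>n. ln (real (n choose k))) = (\<Sum>j=1..n. real j * ln (real j) - ln (fact j))"
proof (induction n)
  case (Suc n)
  have "ln (real (Suc n choose k)) = ln (real (n choose k)) + (ln (real (Suc n)) - ln (real (Suc n - k)))"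
    if "k \<le> n" for k
  proof -
    have "real (Suc n choose k) * real (Suc n - k) = real (Suc n) * real (n choose k)"
      using that by (metis binomial_absorb_comp diff_Suc_1 mult.commute of_nat_mult)
    then have "ln (real (Suc n choose k) * real (Suc n - k)) = ln (real (Suc n) * real (n choose k))" by simp
    moreover have "ln (real (Suc n choose k) * real (Suc n - k)) = ln (real (Suc n choose k)) + ln (real (Suc n - k))"
      using that by (intro ln_mult_pos) auto
    moreover have "ln (real (Suc n) * real (n choose k)) = ln (real (Suc n)) + ln (real (n choose k))"
      using that by (intro ln_mult_pos) auto
    ultimately show ?thesis by linarith
  qed
  then have "(\<Sum>k\<le>Suc n. ln (real (Suc n choose k)))
      = (\<Sum>k\<le>n. ln (real (n choose k)) + (ln (real (Suc n)) - ln (real (Suc n - k))))"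
    by simp
  also have "\<dots> = (\<Sum>k\<le>n. ln (real (n choose k))) + real (Suc n) * ln (real (Suc n)) - (\<Sum>k\<le>n. ln (real (Suc n - k)))"
    by (simp add: sum.distrib sum_subtractf)
  also have "(\<Sum>k\<le>n. ln (real (Suc n - k))) = ln (fact (Suc n))"
  proof -
    have "(\<Sum>k\<le>n. ln (real (Suc n - k))) = (\<Sum>i\<in>{1..Suc n}. ln (real i))"
      by (rule sum.reindex_bij_witness[of _ "\<lambda>i. Suc n - i" "\<lambda>k. Suc n - k"]) auto
    also have "\<dots> = ln (fact (Suc n))"
      unfolding fact_prod of_nat_prod by (subst ln_prod) auto
    finally show ?thesis .
  qed
  finally show ?case using Suc.IH by simp
qed simp

lemma sum_ln_binomial_le:
  "(\<Sum>k\<le>n. ln (real (n choose k))) \<le> real n * (real n + 1) / 2 - ln (fact n) / 2 - 3 / 4 * real n"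
proof -
  have "(\<Sum>k\<le>n. ln (real (n choose k))) \<le> (\<Sum>j=1..n. real j - ln (real j) / 2 - 3 / 4)"
    unfolding sum_ln_binomial
  proof (rule sum_mono)
    fix j assume "j \<in> {1..n}"
    then have "ln (fact j) \<ge> real j * ln (real j) - real j + ln (real j) / 2 + 3 / 4 + 1 / (4 * real j)"
      by (intro ln_fact_ge_stirling) auto
    moreover have "1 / (4 * real j) \<ge> 0" by simp
    ultimately show "real j * ln (real j) - ln (fact j) \<le> real j - ln (real j) / 2 - 3 / 4" by linarith
  qed
  also have "\<dots> = real n * (real n + 1) / 2 - ln (fact n) / 2 - 3 / 4 * real n"
  proof -
    have "(\<Sum>j=1..n. real j) = real n * (real n + 1) / 2"
      by (induction n) (auto simp: field_simps)
    moreover have "(\<Sum>j=1..n. ln (real j)) = ln (fact n)"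
      unfolding fact_prod of_nat_prod by (subst ln_prod) auto
    ultimately show ?thesis by (simp add: sum_subtractf sum_divide_distrib[symmetric])
  qed
  finally show ?thesis .
qed

lemma min_log_energy_le:
  assumes N: "N \<ge> 1"
  shows "min_log_energy N \<le> (1/2 - ln 2) * (real N)\<^sup>2 - 1/2 * real N * ln (real N)
           + (ln 2 + 1 / 4 + ln (10 / 9)) * real N + ln (real N) / 2 + 3 / 4"
proof -
  obtain p where p: "p ` {1..N} \<subseteq> sphere 0 1" "inj_on p {1..N}"
    and E: "log_energy N p \<le> - real N * (real N - 1) * ln 2 - ln (fact N) + real N * ln (10 / 9)
        + real N * ln (real N) + (\<Sum>k<N. ln (real (N - 1 choose k)))"
    using exists_low_energy[OF N] by blast
  have "min_log_energy N \<le> log_energy N p"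
    unfolding min_log_energy_def
  proof (rule cInf_lower)
    show "bdd_below {log_energy N p | p. p ` {1..N} \<subseteq> sphere 0 1 \<and> inj_on p {1..N}}"
      by (rule bdd_belowI) (use log_energy_ge[OF N] in blast)
  qed (use p in blast)
  also note E
  also have "(\<Sum>k<N. ln (real (N - 1 choose k))) = (\<Sum>k\<le>N - 1. ln (real (N - 1 choose k)))"
    using N by (intro sum.cong) auto
  also have "\<dots> \<le> real (N - 1) * (real (N - 1) + 1) / 2 - ln (fact (N - 1)) / 2 - 3 / 4 * real (N - 1)"
    by (rule sum_ln_binomial_le)
  also have "ln (fact (N - 1)) = ln (fact N) - ln (real N)"
  proof -
    have "(fact N :: real) = real N * fact (N - 1)" using N by (simp add: fact_reduce)
    then show ?thesis using N by (simp add: ln_mult_pos)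
  qed
  also have "real (N - 1) = real N - 1" using N by simp
  also have "(real N - 1) * (real N - 1 + 1) = real N * (real N - 1)" by simp
  finally have upper: "min_log_energy N \<le> - real N * (real N - 1) * ln 2 - ln (fact N) + real N * ln (10 / 9)
      + real N * ln (real N)
      + (real N * (real N - 1) / 2 - (ln (fact N) - ln (real N)) / 2 - 3 / 4 * (real N - 1))"
    by (simp only: add.assoc)
  have fact_ge: "real N * ln (real N) - real N \<le> ln (fact N)"
  proof -
    have "ln (real N) \<ge> 0" "1 / (4 * real N) \<ge> 0" using N by auto
    then show ?thesis using ln_fact_ge_stirling[OF N] by linarith
  qed
  have eqs: "- real N * (real N - 1) * ln 2 = real N * ln 2 - ln 2 * (real N)\<^sup>2"
    "(1/2 - ln 2) * (real N)\<^sup>2 = (real N)\<^sup>2 / 2 - ln 2 * (real N)\<^sup>2"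
    "(ln 2 + 1 / 4 + ln (10 / 9)) * real N = real N * ln 2 + real N / 4 + real N * ln (10 / 9)"
    "1/2 * real N * ln (real N) = (real N * ln (real N)) / 2"
    by (simp_all add: power2_eq_square algebra_simps)
  have eq: "real N * (real N - 1) / 2 = (real N)\<^sup>2 / 2 - real N / 2"
    by (simp add: power2_eq_square right_diff_distrib diff_divide_distrib)
  have collect: "m \<le> (s - x) - b / 2 + (w + n / 4 + v) + l / 2 + 3 / 4"
    if "m \<le> (w - x) - f + v + b + ((s - n / 2) - (f - l) / 2 - 3 / 4 * (n - 1))" "b - n \<le> f"
    for b f l m n s v w x :: real
    using that by argo
  show ?thesis unfolding eqs by (rule collect[OF upper[unfolded eqs eq] fact_ge])
qed

lemma min_log_energy_ge:
  assumes N: "N \<ge> 1"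
  shows "min_log_energy N \<ge> - real N * (real N - 1) * ln 2
           + (real N * (real N - 1) - real N * harm (N - 1)) / 2"
  unfolding min_log_energy_def
proof (rule cInf_greatest)
  obtain p :: "nat \<Rightarrow> real ^ 3" where "p ` {1..N} \<subseteq> sphere 0 1" "inj_on p {1..N}"
    by (rule exists_low_energy[OF N])
  then show "{log_energy N p | p. p ` {1..N} \<subseteq> sphere 0 1 \<and> inj_on p {1..N}} \<noteq> {}"
    by blast
next
  fix e assume "e \<in> {log_energy N p | p. p ` {1..N} \<subseteq> sphere 0 1 \<and> inj_on p {1..N}}"
  then obtain p where p: "e = log_energy N p" "p ` {1..N} \<subseteq> sphere 0 1" "inj_on p {1..N}" by blast
  show "- real N * (real N - 1) * ln 2 + (real N * (real N - 1) - real N * harm (N - 1)) / 2 \<le> e"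
    unfolding p(1) by (rule log_energy_ge[OF N p(2,3)])
qed

abbreviation (input) energy_remainder :: "nat \<Rightarrow> real" where
  "energy_remainder N \<equiv> (min_log_energy N - (1/2 - ln 2) * (real N)\<^sup>2 + 1/2 * real N * ln (real N)) / real N"

lemma C_log_le:
  assumes "energy_remainder \<longlonglongrightarrow> C"
  shows "C \<le> ln 2 + 1 / 4 + ln (10 / 9)"
proof (rule LIMSEQ_le[OF assms])
  show "(\<lambda>N. ln 2 + 1 / 4 + ln (10 / 9) + (ln (real N) / 2 + 3 / 4) / real N) \<longlonglongrightarrow> ln 2 + 1 / 4 + ln (10 / 9)"
    by real_asymp
  show "\<exists>N0. \<forall>N\<ge>N0. energy_remainder N \<le> ln 2 + 1 / 4 + ln (10 / 9) + (ln (real N) / 2 + 3 / 4) / real N"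
  proof (intro exI allI impI)
    fix N :: nat assume N: "1 \<le> N"
    have "energy_remainder N \<le> ((ln 2 + 1 / 4 + ln (10 / 9)) * real N + (ln (real N) / 2 + 3 / 4)) / real N"
      using min_log_energy_le[OF N] by (intro divide_right_mono) auto
    also have "\<dots> = ln 2 + 1 / 4 + ln (10 / 9) + (ln (real N) / 2 + 3 / 4) / real N"
      using N by (simp add: add_divide_distrib)
    finally show "energy_remainder N \<le> ln 2 + 1 / 4 + ln (10 / 9) + (ln (real N) / 2 + 3 / 4) / real N" .
  qed
qed

lemma C_log_ge:
  assumes "energy_remainder \<longlonglongrightarrow> C"
  shows "C \<ge> ln 2 - 1 / 2 - euler_mascheroni / 2"
proof (rule LIMSEQ_le[OF _ assms])
  have "(\<lambda>N. harm N - ln (real N)) \<longlonglongrightarrow> (euler_mascheroni :: real)"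
    using euler_mascheroni_LIMSEQ by simp
  moreover have "(\<lambda>N. 1 / real N) \<longlonglongrightarrow> 0" by real_asymp
  ultimately have "(\<lambda>N. ln 2 - 1 / 2 - (harm N - ln (real N)) / 2 + 1 / real N / 2)
      \<longlonglongrightarrow> ln 2 - 1 / 2 - euler_mascheroni / 2 + 0 / 2"
    by (intro tendsto_intros) auto
  then show "(\<lambda>N. ln 2 - 1 / 2 - (harm N - ln (real N)) / 2 + 1 / real N / 2)
      \<longlonglongrightarrow> ln 2 - 1 / 2 - euler_mascheroni / 2" by simp
  show "\<exists>N0. \<forall>N\<ge>N0. ln 2 - 1 / 2 - (harm N - ln (real N)) / 2 + 1 / real N / 2 \<le> energy_remainder N"
  proof (intro exI allI impI)
    fix N :: nat assume N: "1 \<le> N"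
    have harm: "harm (N - 1) = (harm N :: real) - 1 / real N"
      using N by (cases N) (auto simp: harm_Suc inverse_eq_divide)
    have "ln 2 - 1 / 2 - (harm N - ln (real N)) / 2 + 1 / real N / 2
        = (- real N * (real N - 1) * ln 2 + (real N * (real N - 1) - real N * harm (N - 1)) / 2
            - (1/2 - ln 2) * (real N)\<^sup>2 + 1/2 * real N * ln (real N)) / real N"
      unfolding harm using N by (simp add: field_simps power2_eq_square)
    also have "\<dots> \<le> energy_remainder N"
      using min_log_energy_ge[OF N] by (intro divide_right_mono) auto
    finally show "ln 2 - 1 / 2 - (harm N - ln (real N)) / 2 + 1 / real N / 2 \<le> energy_remainder N" .
  qed
qed

text \<open>
  The lower bound \<open>ln 2 - 1 / 2 - euler_mascheroni / 2\<close>, about \<open>-0.0954\<close>, exceeds the required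
  \<open>-0.1014\<close> only narrowly, so the numerical estimates have to be good to about \<open>0.006\<close>.
\<close>

lemma exp_C_log_ge:
  assumes "energy_remainder \<longlonglongrightarrow> C"
  shows "exp C / (sqrt 3 * exp (15/8)) \<ge> 0.08"
proof -
  \<comment> \<open>Bounding \<open>euler_mascheroni\<close> with \<open>harm 7\<close> involves \<open>ln 8 = 3 * ln 2\<close>, so no numerical value of \<open>ln 2\<close> is needed.\<close>
  have h7: "harm 7 = (363 / 140 :: real)" by (simp add: harm_expand)
  have ln8: "ln (8::real) = 3 * ln 2" using ln_realpow[of 2 3] by simp
  have gam: "euler_mascheroni \<le> 363 / 140 - 3 * ln 2 + (1 / 14 :: real)"
    using euler_mascheroni_bounds[of 7] by (simp add: h7 ln8)
  have "C \<ge> 5 / 2 * ln 2 - 513 / 280"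
    using C_log_ge[OF assms] gam by simp
  then have "exp C \<ge> exp (5 / 2 * ln 2 - 513 / 280)" by simp
  then have "(exp C)\<^sup>2 \<ge> (exp (5 / 2 * ln 2 - 513 / 280))\<^sup>2" by (intro power_mono) auto
  also have "(exp (5 / 2 * ln 2 - 513 / 280))\<^sup>2 = exp (5 * ln 2 - 513 / 140 :: real)"
    by (simp add: power2_eq_square flip: exp_add)
  also have "\<dots> = 32 / exp (513 / 140)"
    using exp_of_nat_mult[of 5 "ln 2 :: real"] by (simp add: exp_diff)
  finally have C2: "(exp C)\<^sup>2 \<ge> 32 / exp (513 / 140)" .
  have "exp (513 / 140) * exp (15 / 4 :: real) = exp (519 / 70)" by (simp flip: exp_add)
  moreover have "exp (519 / 70 :: real) \<le> 5000 / 3"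
  proof -
    \<comment> \<open>\<open>519 / 70 = 15 / 2 - 3 / 35\<close>: a half-integer, whose exponential squares to a power of \<open>exp 1\<close>, and a
      small remainder.\<close>
    have e: "exp 1 \<le> (27183 / 10000 :: real)"
      using abs_le_D1[OF e_approx_32] by simp
    have "exp (15 / 2 :: real) ^ 2 = exp 1 ^ 15" by (simp flip: exp_of_nat_mult)
    also have "\<dots> \<le> (27183 / 10000) ^ 15" by (intro power_mono e) auto
    also have "\<dots> \<le> (38000 / 21) ^ 2" by (simp add: power_divide)
    finally have "exp (15 / 2 :: real) \<le> 38000 / 21" by (rule power2_le_imp_le) simp
    then have "exp (15 / 2) / exp (3 / 35) \<le> (38000 / 21) / (38 / 35 :: real)"
      using exp_ge_add_one_self[of "3 / 35 :: real"] by (intro frac_le) auto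
    also have "exp (15 / 2) / exp (3 / 35) = exp (519 / 70 :: real)" by (simp add: exp_diff[symmetric])
    finally show ?thesis by simp
  qed
  ultimately have bound: "exp (513 / 140) * exp (15 / 4) \<le> (5000 / 3 :: real)" by simp
  have "(0.08 * (sqrt 3 * exp (15/8)))\<^sup>2 = 0.0192 * exp (15 / 4 :: real)"
    by (simp add: power_mult_distrib power2_eq_square flip: exp_add)
  also have "\<dots> \<le> 32 / exp (513 / 140)"
    using bound by (simp add: pos_le_divide_eq mult_ac)
  also note C2
  finally have "0.08 * (sqrt 3 * exp (15/8)) \<le> exp C" by (rule power2_le_imp_le) simp
  then show ?thesis by (simp add: pos_le_divide_eq)
qed

text \<open>
  There is ample room here: \<open>ln 2 + 1 / 4 + ln (10 / 9)\<close> is about \<open>1.05\<close>, and the inequality holds for \<open>C\<close> up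
  to about \<open>1.29\<close>.
\<close>

lemma exp_C_log_le:
  assumes "energy_remainder \<longlonglongrightarrow> C"
  shows "exp C / (sqrt 3 * exp (15/8)) \<le> exp (- 2 / sqrt pi)"
proof -
  have s3: "exp (ln 3 / 2) = sqrt (3::real)"
    by (simp add: powr_half_sqrt[symmetric] powr_def)
  have "2 / sqrt pi \<le> 2 / sqrt 3"
    using pi_gt3 by (intro divide_left_mono) auto
  also have "\<dots> \<le> 6 / 5"
  proof -
    have "5 / 3 \<le> sqrt (3::real)" by (rule real_le_rsqrt) (simp add: power2_eq_square)
    then show ?thesis by (simp add: pos_divide_le_eq)
  qed
  finally have pi: "2 / sqrt pi \<le> 6 / 5" .
  have "ln 2 \<le> (25 / 36 :: real)" by (rule ln2_le_25_over_36)
  moreover have "ln (10 / 9 :: real) \<le> 1 / 9" using ln_le_minus_one[of "10 / 9 :: real"] by simp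
  moreover have "ln 3 \<ge> (1 :: real)" using exp_le by (subst ln_ge_iff) auto
  ultimately have "C \<le> - 2 / sqrt pi + (ln 3 / 2 + 15 / 8)"
    using C_log_le[OF assms] pi by simp
  then have "exp C \<le> exp (- 2 / sqrt pi + (ln 3 / 2 + 15 / 8))" by simp
  also have "\<dots> = exp (- 2 / sqrt pi) * (sqrt 3 * exp (15/8))" by (simp only: exp_add s3)
  finally show ?thesis by (simp add: pos_divide_le_eq)
qed

section \<open>The lower bound for the Bombieri constant\<close>

theorem mainTheorem3:
  fixes C_log :: real
  assumes "(\<lambda>N. (min_log_energy N - (1/2 - ln 2) * (real N)\<^sup>2
              + 1/2 * real N * ln (real N)) / real N) \<longlonglongrightarrow> C_log"
  shows "limsup (\<lambda>N. ereal (bombieri_K N)) \<ge> ereal (exp C_log / (sqrt 3 * exp (15/8)))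
       \<and> exp C_log / (sqrt 3 * exp (15/8)) \<ge> 0.08"
proof
  have "ereal (exp C_log / (sqrt 3 * exp (15/8))) \<le> ereal (bombieri_K N)" for N
    using order.trans[OF exp_C_log_le[OF assms] bombieri_K_ge[of N]] by (simp only: ereal_less_eq)
  then have "\<forall>N. ereal (exp C_log / (sqrt 3 * exp (15/8))) \<le> ereal (bombieri_K N)" ..
  then show "limsup (\<lambda>N. ereal (bombieri_K N)) \<ge> ereal (exp C_log / (sqrt 3 * exp (15/8)))"
    by (rule le_Limsup[OF trivial_limit_sequentially always_eventually])
  show "exp C_log / (sqrt 3 * exp (15/8)) \<ge> 0.08"
    by (rule exp_C_log_ge[OF assms])
qed

end
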